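(* There is an absolute constant $c > 0$ such that the following holds. Suppose $\Phi:\mathrm{Mat}(p)\to\mathrm{Mat}(n)$ is an $(\varepsilon, 1-\lambda)$-quantum expander with $\lambda\in(0,1]$ and $\varepsilon\sqrt{p}/\lambda \leq c$. Then there are $L \in \mathrm{GL}(p)$, $R\in\mathrm{GL}(n)$ with $\det L = \det R = 1$ such that $\Phi_{L,R}$ is doubly balanced and $$\|I_p - L^\dagger L\|_F = O(\varepsilon\sqrt{p}/\lambda), \qquad \|I_n - R^\dagger R\|_{op} = O(\varepsilon\sqrt{p}/\lambda),$$ where the implied constants are absolute.
   Context: A completely positive map $\Phi:\mathrm{Mat}(p)\to\mathrm{Mat}(n)$ is $\Phi(Y) = \sum_{i=1}^r A_i Y A_i^\dagger$ with $A_i \in \mathbb{C}^{n\times p}$; $s(\Phi) = \operatorname{tr}\Phi(I_p)$; $\Phi^*(Y) = \sum_i A_i^\dagger Y A_i$. $\Phi$ is $\varepsilon$-doubly balanced if $\|\Phi(I_p) - s(\Phi) I_n/n\|_{op} \leq s(\Phi)\varepsilon/n$ and $\|\Phi^*(I_n) - s(\Phi)I_p/p\|_{op} \leq s(\Phi)\varepsilon/p$; doubly balanced means $0$-doubly balanced. $\Phi$ is an $(\varepsilon,1-\lambda)$-quantum expander if it is $\varepsilon$-doubly balanced and $\|\Phi(X)\|_F \leq (1-\lambda)\frac{s(\Phi)}{\sqrt{np}}\|X\|_F$ for all Hermitian $p\times p$ $X$ with $\operatorname{tr}X=0$. For $L\in\mathrm{GL}(p)$, $R\in\mathrm{GL}(n)$,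 the scaling is $\Phi_{L,R}(X) = R\,\Phi(L^\dagger X L)\,R^\dagger$. *)

theory Defs
  imports Complex_Main "Jordan_Normal_Form.Schur_Decomposition"
begin

text \<open>Matrices are those of \<open>Jordan_Normal_Form\<close>, whose dimensions are natural numbers rather than
  types, so that the dimensions can be quantified inside the scope of absolute constants.\<close>

definition mat_trace :: "complex mat \<Rightarrow> complex" where
  "mat_trace A = (\<Sum>i<dim_row A. A $$ (i, i))"

definition hermitian_mat :: "complex mat \<Rightarrow> bool" where
  "hermitian_mat A \<longleftrightarrow> mat_adjoint A = A"

definition frob_norm :: "complex mat \<Rightarrow> real" where
  "frob_norm A = sqrt (\<Sum>i<dim_row A. \<Sum>j<dim_col A. (cmod (A $$ (i, j)))\<^sup>2)"

definition l2_norm_vec :: "complex vec \<Rightarrow> real" where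
  "l2_norm_vec v = sqrt (\<Sum>i<dim_vec v. (cmod (v $ i))\<^sup>2)"

definition op_norm_mat :: "complex mat \<Rightarrow> real" where
  "op_norm_mat A = Sup {l2_norm_vec (A *\<^sub>v v) | v. v \<in> carrier_vec (dim_col A) \<and> l2_norm_vec v \<le> 1}"

definition kraus_map :: "nat \<Rightarrow> complex mat list \<Rightarrow> complex mat \<Rightarrow> complex mat" where
  "kraus_map n As Y = mat n n (\<lambda>ij. \<Sum>A\<leftarrow>As. (A * Y * mat_adjoint A) $$ ij)"

definition kraus_dual :: "nat \<Rightarrow> complex mat list \<Rightarrow> complex mat \<Rightarrow> complex mat" where
  "kraus_dual p As Y = mat p p (\<lambda>ij. \<Sum>A\<leftarrow>As. (mat_adjoint A * Y * A) $$ ij)"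

text \<open>A map from \<open>p \<times> p\<close> to \<open>n \<times> n\<close> matrices is a function on all matrices of which only the
  values on \<open>carrier_mat p p\<close> matter.\<close>

definition kraus_rep :: "nat \<Rightarrow> nat \<Rightarrow> (complex mat \<Rightarrow> complex mat) \<Rightarrow> complex mat list \<Rightarrow> bool" where
  "kraus_rep p n \<Phi> As \<longleftrightarrow>
     set As \<subseteq> carrier_mat n p \<and> (\<forall>Y \<in> carrier_mat p p. \<Phi> Y = kraus_map n As Y)"

definition completely_positive :: "nat \<Rightarrow> nat \<Rightarrow> (complex mat \<Rightarrow> complex mat) \<Rightarrow> bool" where
  "completely_positive p n \<Phi> \<longleftrightarrow> (\<exists>As. kraus_rep p n \<Phi> As)"

text \<open>The choice of the Kraus operators is immaterial, see \<open>dual_map_eq\<close> below.\<close>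

definition dual_map ::
  "nat \<Rightarrow> nat \<Rightarrow> (complex mat \<Rightarrow> complex mat) \<Rightarrow> complex mat \<Rightarrow> complex mat" where
  "dual_map p n \<Phi> = kraus_dual p (SOME As. kraus_rep p n \<Phi> As)"

text \<open>The trace is real for completely positive \<open>\<Phi>\<close>, see \<open>map_size_complex\<close> below.\<close>

definition map_size :: "nat \<Rightarrow> (complex mat \<Rightarrow> complex mat) \<Rightarrow> real" where
  "map_size p \<Phi> = Re (mat_trace (\<Phi> (1\<^sub>m p)))"

definition eps_doubly_balanced ::
  "nat \<Rightarrow> nat \<Rightarrow> real \<Rightarrow> (complex mat \<Rightarrow> complex mat) \<Rightarrow> bool" where
  "eps_doubly_balanced p n \<epsilon> \<Phi> \<longleftrightarrow>
     op_norm_mat (\<Phi> (1\<^sub>m p) - complex_of_real (map_size p \<Phi> / real n) \<cdot>\<^sub>m 1\<^sub>m n)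
       \<le> map_size p \<Phi> * \<epsilon> / real n \<and>
     op_norm_mat (dual_map p n \<Phi> (1\<^sub>m n) - complex_of_real (map_size p \<Phi> / real p) \<cdot>\<^sub>m 1\<^sub>m p)
       \<le> map_size p \<Phi> * \<epsilon> / real p"

definition doubly_balanced :: "nat \<Rightarrow> nat \<Rightarrow> (complex mat \<Rightarrow> complex mat) \<Rightarrow> bool" where
  "doubly_balanced p n \<Phi> \<longleftrightarrow> eps_doubly_balanced p n 0 \<Phi>"

text \<open>The parameter \<open>\<mu>\<close> plays the role of \<open>1 - \<lambda>\<close>.\<close>

definition quantum_expander ::
  "nat \<Rightarrow> nat \<Rightarrow> real \<Rightarrow> real \<Rightarrow> (complex mat \<Rightarrow> complex mat) \<Rightarrow> bool" where
  "quantum_expander p n \<epsilon> \<mu> \<Phi> \<longleftrightarrow>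
     eps_doubly_balanced p n \<epsilon> \<Phi> \<and>
     (\<forall>X \<in> carrier_mat p p. hermitian_mat X \<and> mat_trace X = 0 \<longrightarrow>
        frob_norm (\<Phi> X) \<le> \<mu> * (map_size p \<Phi> / sqrt (real n * real p)) * frob_norm X)"

definition scaling ::
  "(complex mat \<Rightarrow> complex mat) \<Rightarrow> complex mat \<Rightarrow> complex mat \<Rightarrow> complex mat \<Rightarrow> complex mat" where
  "scaling \<Phi> L R X = R * \<Phi> (mat_adjoint L * X * L) * mat_adjoint R"


lemma mat_adjoint_carrier:
  "A \<in> carrier_mat n p \<Longrightarrow> mat_adjoint A \<in> carrier_mat p n"
  unfolding mat_adjoint_def carrier_mat_def by simp

lemma dim_mat_adjoint [simp]:
  "dim_row (mat_adjoint A) = dim_col A" "dim_col (mat_adjoint A) = dim_row A"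
  unfolding mat_adjoint_def by simp_all

lemma index_mat_adjoint:
  assumes "i < dim_col A" "j < dim_row A"
  shows "mat_adjoint A $$ (i, j) = cnj (A $$ (j, i))"
  using assms unfolding mat_adjoint_def by (simp add: mat_of_rows_index)

lemma mat_adjoint_mult:
  assumes "A \<in> carrier_mat n m" "B \<in> carrier_mat m p"
  shows "mat_adjoint (A * B) = mat_adjoint B * mat_adjoint (A :: complex mat)"
proof (rule eq_matI)
  fix i j assume "i < dim_row (mat_adjoint B * mat_adjoint A)" "j < dim_col (mat_adjoint B * mat_adjoint A)"
  with assms have ij: "i < p" "j < n" by auto
  show "mat_adjoint (A * B) $$ (i, j) = (mat_adjoint B * mat_adjoint A) $$ (i, j)"
    using assms ij by (simp add: index_mat_adjoint scalar_prod_def mult.commute)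
qed (use assms in auto)

lemma mat_adjoint_adjoint: "mat_adjoint (mat_adjoint A) = (A :: complex mat)"
  by (rule eq_matI) (auto simp: index_mat_adjoint)

lemma index_sandwich:
  assumes "B \<in> carrier_mat a b" "Y \<in> carrier_mat b c" "C \<in> carrier_mat c d" "i < a" "j < d"
  shows "(B * Y * C) $$ (i, j) = (\<Sum>l<c. \<Sum>k<b. B $$ (i, k) * Y $$ (k, l) * (C $$ (l, j) :: complex))"
  using assms by (simp add: scalar_prod_def sum_distrib_right atLeast0LessThan del: assoc_mult_mat)

lemma kraus_dual_index:
  assumes As: "set As \<subseteq> carrier_mat n p" and Y: "Y \<in> carrier_mat n n" and ij: "i < p" "j < p"
  shows "kraus_dual p As Y $$ (i, j) =
    (\<Sum>l<n. \<Sum>k<n. Y $$ (k, l) * kraus_map n As (mat p p (\<lambda>ab. if ab = (j, i) then 1 else 0)) $$ (l, k))"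
proof -
  let ?E = "mat p p (\<lambda>ab. if ab = (j, i) then 1 else 0) :: complex mat"
  have E: "(A * ?E * mat_adjoint A) $$ (l, k) = A $$ (l, j) * cnj (A $$ (k, i))"
    if A: "A \<in> set As" and lk: "l < n" "k < n" for A l k
  proof -
    have Ac: "A \<in> carrier_mat n p" using As A by auto
    have "(A * ?E * mat_adjoint A) $$ (l, k)
        = (\<Sum>y<p. \<Sum>x<p. A $$ (l, x) * ?E $$ (x, y) * mat_adjoint A $$ (y, k))"
      using lk Ac by (intro index_sandwich) (auto intro: mat_adjoint_carrier)
    also have "\<dots> = (\<Sum>y<p. \<Sum>x<p. if x = j then (if y = i then A $$ (l, x) * mat_adjoint A $$ (y, k) else 0) else 0)"
      by (intro sum.cong) auto
    also have "\<dots> = A $$ (l, j) * mat_adjoint A $$ (i, k)"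
      using ij by (simp add: sum.delta)
    finally show ?thesis using Ac lk ij by (simp add: index_mat_adjoint)
  qed
  have S: "kraus_map n As ?E $$ (l, k) = (\<Sum>A\<leftarrow>As. A $$ (l, j) * cnj (A $$ (k, i)))"
    if "l < n" "k < n" for l k
    unfolding kraus_map_def using that E by (auto intro!: arg_cong[where f = sum_list])
  have D: "(mat_adjoint A * Y * A) $$ (i, j) = (\<Sum>l<n. \<Sum>k<n. Y $$ (k, l) * (A $$ (l, j) * cnj (A $$ (k, i))))"
    if A: "A \<in> set As" for A
  proof -
    have Ac: "A \<in> carrier_mat n p" using As A by auto
    have "(mat_adjoint A * Y * A) $$ (i, j)
        = (\<Sum>l<n. \<Sum>k<n. mat_adjoint A $$ (i, k) * Y $$ (k, l) * A $$ (l, j))"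
      using Ac Y ij by (intro index_sandwich) (auto intro: mat_adjoint_carrier)
    also have "\<dots> = (\<Sum>l<n. \<Sum>k<n. Y $$ (k, l) * (A $$ (l, j) * cnj (A $$ (k, i))))"
      using Ac ij by (intro sum.cong) (auto simp: index_mat_adjoint)
    finally show ?thesis .
  qed
  have sw: "(\<Sum>A\<leftarrow>Bs. \<Sum>l<n. \<Sum>k<n. Y $$ (k, l) * (A $$ (l, j) * cnj (A $$ (k, i))))
      = (\<Sum>l<n. \<Sum>k<n. Y $$ (k, l) * (\<Sum>A\<leftarrow>Bs. A $$ (l, j) * cnj (A $$ (k, i))))" for Bs
    by (induction Bs) (simp_all add: sum.distrib distrib_left)
  have "kraus_dual p As Y $$ (i, j) = (\<Sum>A\<leftarrow>As. \<Sum>l<n. \<Sum>k<n. Y $$ (k, l) * (A $$ (l, j) * cnj (A $$ (k, i))))"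
    unfolding kraus_dual_def using ij D by (auto intro!: arg_cong[where f = sum_list])
  also have "\<dots> = (\<Sum>l<n. \<Sum>k<n. Y $$ (k, l) * kraus_map n As ?E $$ (l, k))"
    unfolding sw using S by (intro sum.cong) auto
  finally show ?thesis .
qed

lemma dual_map_eq:
  assumes rep: "kraus_rep p n \<Phi> As" and Y: "Y \<in> carrier_mat n n"
  shows "dual_map p n \<Phi> Y = kraus_dual p As Y"
proof -
  define Bs where "Bs = (SOME As. kraus_rep p n \<Phi> As)"
  have repB: "kraus_rep p n \<Phi> Bs" unfolding Bs_def using rep by (rule someI)
  have eq: "kraus_map n Bs Z = kraus_map n As Z" if "Z \<in> carrier_mat p p" for Z
    using rep repB that unfolding kraus_rep_def by metis
  have "kraus_dual p Bs Y = kraus_dual p As Y"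
  proof (rule eq_matI)
    fix i j assume "i < dim_row (kraus_dual p As Y)" "j < dim_col (kraus_dual p As Y)"
    then have ij: "i < p" "j < p" by (auto simp: kraus_dual_def)
    show "kraus_dual p Bs Y $$ (i, j) = kraus_dual p As Y $$ (i, j)"
      using rep repB Y ij by (simp add: kraus_rep_def kraus_dual_index[of _ n] eq)
  qed (auto simp: kraus_dual_def)
  then show ?thesis unfolding dual_map_def Bs_def .
qed

lemma map_size_complex:
  assumes "completely_positive p n \<Phi>"
  shows "complex_of_real (map_size p \<Phi>) = mat_trace (\<Phi> (1\<^sub>m p))"
proof -
  obtain As where As: "set As \<subseteq> carrier_mat n p" and rep: "\<Phi> (1\<^sub>m p) = kraus_map n As (1\<^sub>m p)"
    using assms unfolding completely_positive_def kraus_rep_def by auto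
  have r: "(A * 1\<^sub>m p * mat_adjoint A) $$ (i, i) \<in> \<real>" if A: "A \<in> set As" and i: "i < n" for A i
  proof -
    have Ac: "A \<in> carrier_mat n p" using As A by auto
    have "(A * 1\<^sub>m p * mat_adjoint A) $$ (i, i) = (\<Sum>k<p. A $$ (i, k) * cnj (A $$ (i, k)))"
      using Ac i by (simp add: scalar_prod_def index_mat_adjoint atLeast0LessThan)
    also have "\<dots> \<in> \<real>" by (intro sum_in_Reals) (simp add: complex_mult_cnj del: of_real_add)
    finally show ?thesis .
  qed
  have sl: "(\<And>x. x \<in> set xs \<Longrightarrow> f x \<in> \<real>) \<Longrightarrow> sum_list (map f xs) \<in> \<real>"
    for f :: "complex mat \<Rightarrow> complex" and xs by (induction xs) auto
  have "mat_trace (\<Phi> (1\<^sub>m p)) \<in> \<real>"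
    unfolding rep mat_trace_def kraus_map_def by (auto intro!: sum_in_Reals sl r)
  then show ?thesis unfolding map_size_def by (simp add: of_real_Re)
qed

lemma kraus_rep_scaling:
  assumes rep: "kraus_rep p n \<Phi> As" and L: "L \<in> carrier_mat p p" and R: "R \<in> carrier_mat n n"
  shows "kraus_rep p n (scaling \<Phi> L R) (map (\<lambda>A. R * A * mat_adjoint L) As)"
  unfolding kraus_rep_def
proof (intro conjI ballI)
  note L' = mat_adjoint_carrier[OF L] and R' = mat_adjoint_carrier[OF R]
  have As: "set As \<subseteq> carrier_mat n p" using rep unfolding kraus_rep_def by auto
  show "set (map (\<lambda>A. R * A * mat_adjoint L) As) \<subseteq> carrier_mat n p" using As L' R by auto
  fix Y :: "complex mat" assume Y: "Y \<in> carrier_mat p p"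
  let ?Z = "mat_adjoint L * Y * L"
  have Z: "?Z \<in> carrier_mat p p" using L L' Y by auto
  have \<Phi>: "\<Phi> ?Z = kraus_map n As ?Z" using rep Z unfolding kraus_rep_def by auto
  have K: "kraus_map n As ?Z \<in> carrier_mat n n" by (simp add: kraus_map_def)
  show "scaling \<Phi> L R Y = kraus_map n (map (\<lambda>A. R * A * mat_adjoint L) As) Y"
  proof (rule eq_matI)
    fix i j assume "i < dim_row (kraus_map n (map (\<lambda>A. R * A * mat_adjoint L) As) Y)"
      "j < dim_col (kraus_map n (map (\<lambda>A. R * A * mat_adjoint L) As) Y)"
    then have ij: "i < n" "j < n" by (auto simp: kraus_map_def)
    have one: "(R * A * mat_adjoint L * Y * mat_adjoint (R * A * mat_adjoint L)) $$ (i, j)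
        = (\<Sum>l<n. \<Sum>k<n. R $$ (i, k) * (A * ?Z * mat_adjoint A) $$ (k, l) * mat_adjoint R $$ (l, j))"
      if "A \<in> set As" for A
    proof -
      have A: "A \<in> carrier_mat n p" using As that by auto
      note A' = mat_adjoint_carrier[OF A]
      have "mat_adjoint (R * A * mat_adjoint L) = L * (mat_adjoint A * mat_adjoint R)"
        using mat_adjoint_mult[of "R * A" n p "mat_adjoint L" p] mat_adjoint_mult[OF R A] A R L'
        by (simp add: mat_adjoint_adjoint del: assoc_mult_mat)
      then have "R * A * mat_adjoint L * Y * mat_adjoint (R * A * mat_adjoint L)
          = R * A * mat_adjoint L * Y * (L * (mat_adjoint A * mat_adjoint R))" by simp
      also have "\<dots> = R * (A * ?Z * mat_adjoint A) * mat_adjoint R"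
        using A A' R R' L L' Y
        by (smt (verit, best) assoc_mult_mat mult_carrier_mat)
      finally show ?thesis
        using index_sandwich[OF R _ R' ij, of "A * ?Z * mat_adjoint A"] A A' Z by simp
    qed
    have sw: "(\<Sum>l<n. \<Sum>k<n. R $$ (i, k) * (\<Sum>A\<leftarrow>Bs. f A k l) * mat_adjoint R $$ (l, j))
        = (\<Sum>A\<leftarrow>Bs. \<Sum>l<n. \<Sum>k<n. R $$ (i, k) * f A k l * mat_adjoint R $$ (l, j))"
      for f :: "complex mat \<Rightarrow> nat \<Rightarrow> nat \<Rightarrow> complex" and Bs
      by (induction Bs) (simp_all add: sum.distrib distrib_left distrib_right)
    have "scaling \<Phi> L R Y $$ (i, j)
        = (\<Sum>l<n. \<Sum>k<n. R $$ (i, k) * kraus_map n As ?Z $$ (k, l) * mat_adjoint R $$ (l, j))"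
      unfolding scaling_def \<Phi> by (rule index_sandwich[OF R K R' ij])
    also have "\<dots> = (\<Sum>l<n. \<Sum>k<n. R $$ (i, k) * (\<Sum>A\<leftarrow>As. (A * ?Z * mat_adjoint A) $$ (k, l)) * mat_adjoint R $$ (l, j))"
      by (intro sum.cong) (auto simp: kraus_map_def)
    also have "\<dots> = (\<Sum>A\<leftarrow>As. (R * A * mat_adjoint L * Y * mat_adjoint (R * A * mat_adjoint L)) $$ (i, j))"
      unfolding sw using one by (auto intro!: arg_cong[where f = sum_list])
    finally show "scaling \<Phi> L R Y $$ (i, j) = kraus_map n (map (\<lambda>A. R * A * mat_adjoint L) As) Y $$ (i, j)"
      using ij by (simp add: kraus_map_def comp_def)
  qed (use R R' in \<open>auto simp: kraus_map_def scaling_def\<close>)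
qed

lemma completely_positive_scaling:
  assumes "completely_positive p n \<Phi>" "L \<in> carrier_mat p p" "R \<in> carrier_mat n n"
  shows "completely_positive p n (scaling \<Phi> L R)"
  using assms kraus_rep_scaling unfolding completely_positive_def by blast

end

theory Submission
  imports "HOL-Analysis.Convex" "HOL-Analysis.Function_Topology" "HOL-Analysis.Topology_Euclidean_Space"
    "Jordan_Normal_Form.Spectral_Radius" Defs
begin

text \<open>
  The factor \<open>L\<close> is the square root of a minimiser \<open>X\<close> of \<open>det (\<Phi> X)\<close> over the Hermitian matrices of
  determinant one in a fixed Frobenius ball around the identity, and \<open>R\<close> is the inverse square root of
  \<open>\<Phi> X\<close>, normalised to determinant one. If \<open>X\<close> is interior, the first-order conditions at \<open>X\<close> are
  exactly double balancedness.

  To locate \<open>X\<close>, write \<open>X = U diag(exp z) U\<^sup>*\<close> and \<open>\<Phi> X = V diag(m) V\<^sup>*\<close>. Then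
  \<open>m k = (\<Sum>l. b k l * exp (z l))\<close>, where \<open>b k l\<close> sums the squared moduli of the \<open>(k, l)\<close> entries of
  \<open>V\<^sup>* A U\<close> over the Kraus operators \<open>A\<close>. The matrix \<open>b\<close> inherits almost constant row and column sums and
  the spectral gap, so the bound on \<open>z\<close> is a statement about scaling a nonnegative matrix: moving from
  \<open>0\<close> to \<open>z\<close> changes the objective by a linear term of order \<open>\<epsilon>\<close> plus a quadratic term of order \<open>\<lambda>\<close>.
  The quadratic term keeps its order \<open>\<lambda>\<close> throughout a ball of constant radius, which is why smallness of
  \<open>\<epsilon> sqrt p / \<lambda>\<close>, rather than of \<open>\<epsilon> sqrt p / \<lambda>\<^sup>2\<close>, is enough.
\<close>

unbundle no vec_syntax

section \<open>Inequalities for real numbers\<close>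

lemma exp_ge_quadratic:
  fixes x :: real
  assumes "-2 \<le> x"
  shows "1 + x + x\<^sup>2 / 4 \<le> exp x"
proof -
  have "1 + x + x\<^sup>2 / 4 = (1 + x / 2)\<^sup>2" by (simp add: power2_eq_square field_simps)
  also have "\<dots> \<le> (exp (x / 2))\<^sup>2"
    using exp_ge_add_one_self[of "x / 2"] assms by (intro power_mono) auto
  also have "\<dots> = exp x" by (simp add: power2_eq_square flip: exp_add)
  finally show ?thesis .
qed

lemma L2_set_abs: "L2_set (\<lambda>i. \<bar>f i\<bar>) I = L2_set f I"
  by (simp add: L2_set_def)

lemma norm_sum_mult_le_L2_set:
  fixes f g :: "'i \<Rightarrow> 'a :: real_normed_div_algebra"
  shows "norm (\<Sum>i\<in>I. f i * g i) \<le> L2_set (\<lambda>i. norm (f i)) I * L2_set (\<lambda>i. norm (g i)) I"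
proof -
  have "norm (\<Sum>i\<in>I. f i * g i) \<le> (\<Sum>i\<in>I. \<bar>norm (f i)\<bar> * \<bar>norm (g i)\<bar>)"
    by (rule order_trans[OF norm_sum]) (simp add: norm_mult)
  also have "\<dots> \<le> L2_set (\<lambda>i. norm (f i)) I * L2_set (\<lambda>i. norm (g i)) I" by (rule L2_set_mult_ineq)
  finally show ?thesis .
qed

lemma abs_sum_mult_le_L2_set: "\<bar>\<Sum>i\<in>I. f i * g i\<bar> \<le> L2_set f I * L2_set g I"
  using norm_sum_mult_le_L2_set[of f g I] by (simp add: L2_set_abs)

lemma abs_le_L2_set: "finite I \<Longrightarrow> i \<in> I \<Longrightarrow> \<bar>f i\<bar> \<le> L2_set f I"
  using member_le_L2_set[of I i "\<lambda>i. \<bar>f i\<bar>"] by (simp add: L2_set_abs)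

lemma L2_set_square: "(L2_set f I)\<^sup>2 = (\<Sum>i\<in>I. (f i)\<^sup>2)"
  unfolding L2_set_def by (simp add: sum_nonneg)

lemma prod_le_mean_power:
  fixes x :: "'i \<Rightarrow> real"
  assumes I: "finite I" "I \<noteq> {}" and x: "\<And>i. i \<in> I \<Longrightarrow> 0 \<le> x i"
  shows "(\<Prod>i\<in>I. x i) \<le> ((\<Sum>i\<in>I. x i) / card I) ^ card I"
proof -
  have card: "0 < card I" using I by (simp add: card_gt_0_iff)
  have nonneg: "0 \<le> (\<Prod>i\<in>I. x i)" using x by (intro prod_nonneg) auto
  then have "root (card I) (\<Prod>i\<in>I. x i) \<le> (\<Sum>i\<in>I. x i) / card I"
    using arith_geom_mean[OF I x] card by (simp add: root_powr_inverse sum_divide_distrib)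
  then have "root (card I) (\<Prod>i\<in>I. x i) ^ card I \<le> ((\<Sum>i\<in>I. x i) / card I) ^ card I"
    using nonneg by (intro power_mono real_root_ge_zero)
  then show ?thesis using card nonneg by simp
qed

lemma geometric_mean_bounds:
  fixes x :: "'i \<Rightarrow> real"
  assumes I: "finite I" "I \<noteq> {}" and lo: "0 \<le> lo" and x: "\<And>i. i \<in> I \<Longrightarrow> lo \<le> x i" "\<And>i. i \<in> I \<Longrightarrow> x i \<le> hi"
  obtains g where "lo \<le> g" "g \<le> hi" "g ^ card I = (\<Prod>i\<in>I. x i)"
proof
  let ?g = "root (card I) (\<Prod>i\<in>I. x i)"
  have card: "0 < card I" using I by (simp add: card_gt_0_iff)
  have x_nonneg: "0 \<le> x i" if "i \<in> I" for i using lo x(1)[OF that] by simp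
  then have hi: "0 \<le> hi" using I(2) x(2) by force
  have "0 \<le> (\<Prod>i\<in>I. x i)" using x_nonneg by (intro prod_nonneg) auto
  then show "?g ^ card I = (\<Prod>i\<in>I. x i)" using card by simp
  have "(\<Prod>i\<in>I. lo) \<le> (\<Prod>i\<in>I. x i)" using x(1) lo by (intro prod_mono) auto
  then have "root (card I) (lo ^ card I) \<le> ?g" using card by (intro real_root_le_mono) auto
  then show "lo \<le> ?g" using card lo by (simp add: real_root_power_cancel)
  have "(\<Prod>i\<in>I. x i) \<le> (\<Prod>i\<in>I. hi)" using x(2) x_nonneg by (intro prod_mono) auto
  then have "?g \<le> root (card I) (hi ^ card I)" using card by (intro real_root_le_mono) auto
  then show "?g \<le> hi" using card hi by (simp add: real_root_power_cancel)
qed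

lemma abs_ln_bounds:
  fixes x :: real
  assumes "\<bar>x - 1\<bar> \<le> 1 / 3"
  shows "\<bar>x - 1\<bar> \<le> 2 * \<bar>ln x\<bar>" "\<bar>ln x\<bar> \<le> 1 / 2"
proof -
  have x: "2 / 3 \<le> x" "x \<le> 4 / 3" using assms by linarith+
  have upper: "ln x \<le> x - 1" using ln_le_minus_one[of x] x by simp
  have lower: "1 - 1 / x \<le> ln x" using ln_le_minus_one[of "1 / x"] x by (simp add: ln_div)
  have "1 / x \<le> 3 / 2" using x by (simp add: field_simps)
  then show "\<bar>ln x\<bar> \<le> 1 / 2" using upper lower x by (simp add: abs_le_iff)
  have "(x - 1) / 2 \<le> 1 - 1 / x" if "1 \<le> x"
  proof -
    have "(x - 1) / 2 \<le> (x - 1) / x" using that x by (intro divide_left_mono) auto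
    then show ?thesis using that by (simp add: diff_divide_distrib)
  qed
  then show "\<bar>x - 1\<bar> \<le> 2 * \<bar>ln x\<bar>" using upper lower by (cases "1 \<le> x") auto
qed

lemma abs_ratio_minus_one_le:
  fixes q \<theta> g m :: real
  assumes q: "0 < q" and \<theta>: "0 \<le> \<theta>" "\<theta> \<le> 1 / 4"
    and g: "q * (1 - \<theta>)\<^sup>2 \<le> g" "g \<le> q * (1 + \<theta>)\<^sup>2" and m: "q * (1 - \<theta>)\<^sup>2 \<le> m" "m \<le> q * (1 + \<theta>)\<^sup>2"
  shows "\<bar>g / m - 1\<bar> \<le> 8 * \<theta>"
proof -
  have "(3 / 4)\<^sup>2 \<le> (1 - \<theta>)\<^sup>2" using \<theta> by (intro power_mono) auto
  then have "1 / 2 \<le> (1 - \<theta>)\<^sup>2" by (simp add: power2_eq_square)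
  then have "q * (1 / 2) \<le> q * (1 - \<theta>)\<^sup>2" using q by (intro mult_left_mono) auto
  then have m_ge: "q / 2 \<le> m" using m(1) by simp
  then have m_pos: "0 < m" using q by linarith
  have "q * (1 + \<theta>)\<^sup>2 - q * (1 - \<theta>)\<^sup>2 = 4 * \<theta> * q" by (simp add: power2_eq_square algebra_simps)
  then have "\<bar>g - m\<bar> \<le> 4 * \<theta> * q" using g m by (simp add: abs_le_iff)
  also have "\<dots> \<le> 8 * \<theta> * m" using mult_left_mono[OF m_ge, of "8 * \<theta>"] \<theta> by simp
  finally have "\<bar>g - m\<bar> / m \<le> 8 * \<theta>" using m_pos by (simp add: field_simps)
  moreover have "g / m - 1 = (g - m) / m" using m_pos by (simp add: field_simps)
  ultimately show ?thesis using m_pos by simp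
qed

section \<open>Expanding nonnegative matrices\<close>

definition root_mean_square :: "nat \<Rightarrow> (nat \<Rightarrow> real) \<Rightarrow> real" where
  "root_mean_square n x = L2_set x {..<n} / sqrt (real n)"

lemma L2_set_eq_root_mean_square: "L2_set x {..<n} = sqrt (real n) * root_mean_square n x"
  by (simp add: root_mean_square_def)

lemma abs_linear_form_minus_mean_le:
  assumes "\<And>i. i < n \<Longrightarrow> \<bar>d i - a\<bar> \<le> e"
  shows "\<bar>(\<Sum>i<n. d i * x i) - a * (\<Sum>i<n. x i)\<bar> \<le> real n * e * root_mean_square n x"
proof (cases "n = 0")
  case False
  then have e: "0 \<le> e" using assms[of 0] by simp
  have "L2_set (\<lambda>i. d i - a) {..<n} = L2_set (\<lambda>i. \<bar>d i - a\<bar>) {..<n}" by (rule L2_set_abs[symmetric])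
  also have "\<dots> \<le> L2_set (\<lambda>_. e) {..<n}" using assms by (intro L2_set_mono) auto
  also have "\<dots> = sqrt n * e" using e by (simp add: L2_set_constant)
  finally have dev: "L2_set (\<lambda>i. d i - a) {..<n} \<le> sqrt n * e" .
  have "(\<Sum>i<n. d i * x i) - a * (\<Sum>i<n. x i) = (\<Sum>i<n. (d i - a) * x i)"
    by (simp add: left_diff_distrib sum_subtractf sum_distrib_left)
  also have "\<bar>\<dots>\<bar> \<le> L2_set (\<lambda>i. d i - a) {..<n} * L2_set x {..<n}"
    by (rule abs_sum_mult_le_L2_set)
  also have "\<dots> \<le> sqrt n * e * L2_set x {..<n}" by (intro mult_right_mono dev L2_set_nonneg)
  also have "\<dots> = real n * e * root_mean_square n x" by (simp add: L2_set_eq_root_mean_square)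
  finally show ?thesis .
qed simp

lemma sum_mult_squares_ge:
  assumes "\<And>i. i < n \<Longrightarrow> a \<le> d i"
  shows "real n * a * (root_mean_square n x)\<^sup>2 \<le> (\<Sum>i<n. d i * (x i)\<^sup>2)"
proof -
  have "real n * a * (root_mean_square n x)\<^sup>2 = a * (L2_set x {..<n})\<^sup>2"
    by (simp add: L2_set_eq_root_mean_square power_mult_distrib)
  also have "\<dots> = (\<Sum>i<n. a * (x i)\<^sup>2)" by (simp add: L2_set_square sum_distrib_left)
  also have "\<dots> \<le> (\<Sum>i<n. d i * (x i)\<^sup>2)" using assms by (intro sum_mono mult_right_mono) auto
  finally show ?thesis .
qed

lemma expander_quadratic_bound:
  fixes \<zeta> \<omega> \<epsilon> \<mu> :: real
  assumes \<mu>: "0 \<le> \<mu>" "\<mu> < 1" and \<epsilon>: "0 \<le> \<epsilon>" "\<epsilon> \<le> (1 - \<mu>) / 2"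
    and le: "((1 - \<epsilon>) * (\<zeta>\<^sup>2 + \<omega>\<^sup>2) - 2 * \<mu> * \<zeta> * \<omega>) / 4 \<le> \<epsilon> * (\<zeta> + \<omega>)"
  shows "\<zeta> \<le> 12 * (\<epsilon> / (1 - \<mu>))"
proof -
  define a where "a = 8 * (\<epsilon> / (1 - \<mu>))"
  have "(1 - \<epsilon>) * (\<zeta>\<^sup>2 + \<omega>\<^sup>2) - 2 * \<mu> * \<zeta> * \<omega>
      = \<mu> * (\<zeta> - \<omega>)\<^sup>2 + ((1 - \<mu>) / 2 - \<epsilon>) * (\<zeta>\<^sup>2 + \<omega>\<^sup>2) + (1 - \<mu>) / 2 * (\<zeta>\<^sup>2 + \<omega>\<^sup>2)"
    by (simp add: power2_eq_square algebra_simps)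
  moreover have "0 \<le> \<mu> * (\<zeta> - \<omega>)\<^sup>2" "0 \<le> ((1 - \<mu>) / 2 - \<epsilon>) * (\<zeta>\<^sup>2 + \<omega>\<^sup>2)" using \<mu> \<epsilon> by simp_all
  ultimately have "(1 - \<mu>) / 8 * (\<zeta>\<^sup>2 + \<omega>\<^sup>2) \<le> \<epsilon> * (\<zeta> + \<omega>)" using le by simp
  also have "\<dots> = (1 - \<mu>) / 8 * (a * (\<zeta> + \<omega>))" unfolding a_def using \<mu> by simp
  finally have "\<zeta>\<^sup>2 + \<omega>\<^sup>2 \<le> a * (\<zeta> + \<omega>)" using \<mu> by simp
  then have "(\<zeta> - a / 2)\<^sup>2 + (\<omega> - a / 2)\<^sup>2 \<le> a\<^sup>2 / 2" by (simp add: power2_eq_square algebra_simps)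
  then have "(\<zeta> - a / 2)\<^sup>2 \<le> a\<^sup>2" using zero_le_power2[of "\<omega> - a / 2"] zero_le_power2[of a] by linarith
  then have "\<zeta> - a / 2 \<le> a" by (rule power2_le_imp_le) (use \<epsilon> \<mu> in \<open>simp add: a_def\<close>)
  then have "\<zeta> \<le> 3 / 2 * a" by simp
  also have "\<dots> = 12 * (\<epsilon> / (1 - \<mu>))" by (simp add: a_def)
  finally show ?thesis .
qed

locale weight_expander =
  fixes n p :: nat and b :: "nat \<Rightarrow> nat \<Rightarrow> real" and s \<epsilon> \<mu> :: real
  assumes n_pos: "0 < n" and p_pos: "0 < p"
    and weight_nonneg: "0 \<le> b k l"
    and total_weight: "(\<Sum>k<n. \<Sum>l<p. b k l) = s"
    and row_weight: "k < n \<Longrightarrow> \<bar>(\<Sum>l<p. b k l) - s / n\<bar> \<le> s * \<epsilon> / n"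
    and col_weight: "l < p \<Longrightarrow> \<bar>(\<Sum>k<n. b k l) - s / p\<bar> \<le> s * \<epsilon> / p"
    and spectral_gap: "(\<Sum>l<p. z l) = 0 \<Longrightarrow> L2_set (\<lambda>k. \<Sum>l<p. b k l * z l) {..<n}
      \<le> \<mu> * (s / sqrt (real n * real p)) * L2_set z {..<p}"
begin

lemma total_weight_nonneg: "0 \<le> s"
  unfolding total_weight[symmetric] by (intro sum_nonneg weight_nonneg)

lemma row_weight_bounds:
  assumes "k < n"
  shows "s / n * (1 - \<epsilon>) \<le> (\<Sum>l<p. b k l)" "(\<Sum>l<p. b k l) \<le> s / n * (1 + \<epsilon>)"
  using row_weight[OF assms] n_pos by (auto simp: abs_le_iff field_simps)

lemma col_weight_ge: "l < p \<Longrightarrow> s / p * (1 - \<epsilon>) \<le> (\<Sum>k<n. b k l)"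
  using col_weight[of l] p_pos by (auto simp: abs_le_iff field_simps)

lemma weighted_row_sum_bounds:
  assumes x: "\<And>l. l < p \<Longrightarrow> \<bar>x l - 1\<bar> \<le> \<theta>" and \<theta>: "\<epsilon> \<le> \<theta>" "0 \<le> \<theta>" "\<theta> \<le> 1" and k: "k < n"
  shows "s / n * (1 - \<theta>)\<^sup>2 \<le> (\<Sum>l<p. b k l * x l)" "(\<Sum>l<p. b k l * x l) \<le> s / n * (1 + \<theta>)\<^sup>2"
proof -
  have x_bounds: "1 - \<theta> \<le> x l" "x l \<le> 1 + \<theta>" if "l < p" for l
    using x[OF that] by (auto simp: abs_le_iff)
  have "s / n * (1 - \<theta>) \<le> (\<Sum>l<p. b k l)"
    using total_weight_nonneg \<theta>(1)
    by (intro order_trans[OF mult_left_mono row_weight_bounds(1)[OF k]]) auto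
  then have "s / n * (1 - \<theta>) * (1 - \<theta>) \<le> (\<Sum>l<p. b k l) * (1 - \<theta>)"
    using \<theta> by (intro mult_right_mono) auto
  also have "\<dots> \<le> (\<Sum>l<p. b k l * x l)"
    unfolding sum_distrib_right by (intro sum_mono mult_left_mono weight_nonneg x_bounds) simp
  finally show "s / n * (1 - \<theta>)\<^sup>2 \<le> (\<Sum>l<p. b k l * x l)" by (simp add: power2_eq_square mult.assoc)
  have "(\<Sum>l<p. b k l) \<le> s / n * (1 + \<theta>)"
    using total_weight_nonneg \<theta>(1)
    by (intro order_trans[OF row_weight_bounds(2)[OF k] mult_left_mono]) auto
  then have "(\<Sum>l<p. b k l) * (1 + \<theta>) \<le> s / n * (1 + \<theta>) * (1 + \<theta>)"
    using \<theta> by (intro mult_right_mono) auto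
  moreover have "(\<Sum>l<p. b k l * x l) \<le> (\<Sum>l<p. b k l) * (1 + \<theta>)"
    unfolding sum_distrib_right by (intro sum_mono mult_left_mono weight_nonneg x_bounds) simp
  ultimately show "(\<Sum>l<p. b k l * x l) \<le> s / n * (1 + \<theta>)\<^sup>2" by (simp add: power2_eq_square mult.assoc)
qed

lemma sum_second_order_expansion:
  "(\<Sum>k<n. \<Sum>l<p. b k l * (1 + (z l + w k) + (z l + w k)\<^sup>2 / 4))
    = s + (\<Sum>l<p. (\<Sum>k<n. b k l) * z l) + (\<Sum>k<n. (\<Sum>l<p. b k l) * w k)
      + ((\<Sum>l<p. (\<Sum>k<n. b k l) * (z l)\<^sup>2) + (\<Sum>k<n. (\<Sum>l<p. b k l) * (w k)\<^sup>2)
         + 2 * (\<Sum>k<n. (\<Sum>l<p. b k l * z l) * w k)) / 4"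
proof -
  have expand: "b k l * (1 + (z l + w k) + (z l + w k)\<^sup>2 / 4) = b k l + b k l * z l + b k l * w k
      + (b k l * (z l)\<^sup>2 + b k l * (w k)\<^sup>2 + 2 * (b k l * z l * w k)) / 4" for k l
    by (simp add: power2_eq_square field_simps)
  have cols: "(\<Sum>k<n. \<Sum>l<p. b k l * f l) = (\<Sum>l<p. (\<Sum>k<n. b k l) * f l)" for f
    unfolding sum_distrib_right by (rule sum.swap)
  have rows: "(\<Sum>k<n. \<Sum>l<p. b k l * f k) = (\<Sum>k<n. (\<Sum>l<p. b k l) * f k)" for f
    unfolding sum_distrib_right ..
  show ?thesis
    unfolding expand by (simp add: sum.distrib total_weight cols rows
        flip: sum_divide_distrib sum_distrib_left sum_distrib_right)
qed

lemma abs_bilinear_form_le: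
  assumes "(\<Sum>l<p. z l) = 0"
  shows "\<bar>\<Sum>k<n. (\<Sum>l<p. b k l * z l) * w k\<bar> \<le> s * (\<mu> * root_mean_square p z * root_mean_square n w)"
proof -
  have "\<bar>\<Sum>k<n. (\<Sum>l<p. b k l * z l) * w k\<bar>
      \<le> L2_set (\<lambda>k. \<Sum>l<p. b k l * z l) {..<n} * L2_set w {..<n}"
    by (rule abs_sum_mult_le_L2_set)
  also have "\<dots> \<le> \<mu> * (s / sqrt (real n * real p)) * L2_set z {..<p} * L2_set w {..<n}"
    by (intro mult_right_mono spectral_gap assms L2_set_nonneg)
  also have "\<dots> = s * (\<mu> * root_mean_square p z * root_mean_square n w)"
    unfolding L2_set_eq_root_mean_square using n_pos p_pos by (simp add: real_sqrt_mult)
  finally show ?thesis .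
qed

lemma exp_weight_sum_ge:
  assumes z: "(\<Sum>l<p. z l) = 0" and w: "0 \<le> (\<Sum>k<n. w k)"
    and ge: "\<And>k l. k < n \<Longrightarrow> l < p \<Longrightarrow> - 2 \<le> z l + w k"
  defines "\<zeta> \<equiv> root_mean_square p z" and "\<omega> \<equiv> root_mean_square n w"
  shows "s * (1 - \<epsilon> * (\<zeta> + \<omega>) + ((1 - \<epsilon>) * (\<zeta>\<^sup>2 + \<omega>\<^sup>2) - 2 * \<mu> * \<zeta> * \<omega>) / 4)
    \<le> (\<Sum>k<n. \<Sum>l<p. b k l * exp (z l + w k))"
proof -
  have linear_z: "- (s * (\<epsilon> * \<zeta>)) \<le> (\<Sum>l<p. (\<Sum>k<n. b k l) * z l)"
    using abs_linear_form_minus_mean_le[of p "\<lambda>l. \<Sum>k<n. b k l", OF col_weight, where x = z] z p_pos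
    unfolding \<zeta>_def by (simp add: abs_le_iff mult.assoc)
  have "- (s * (\<epsilon> * \<omega>)) \<le> (\<Sum>k<n. (\<Sum>l<p. b k l) * w k) - s / n * (\<Sum>k<n. w k)"
    using abs_linear_form_minus_mean_le[of n "\<lambda>k. \<Sum>l<p. b k l", OF row_weight, where x = w] n_pos
    unfolding \<omega>_def by (simp add: abs_le_iff mult.assoc)
  then have linear_w: "- (s * (\<epsilon> * \<omega>)) \<le> (\<Sum>k<n. (\<Sum>l<p. b k l) * w k)"
    using mult_nonneg_nonneg[of "s / n", OF _ w] total_weight_nonneg by simp
  have square_z: "s * ((1 - \<epsilon>) * \<zeta>\<^sup>2) \<le> (\<Sum>l<p. (\<Sum>k<n. b k l) * (z l)\<^sup>2)"
    using sum_mult_squares_ge[of p _ "\<lambda>l. \<Sum>k<n. b k l", OF col_weight_ge, where x = z] p_pos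
    unfolding \<zeta>_def by simp
  have square_w: "s * ((1 - \<epsilon>) * \<omega>\<^sup>2) \<le> (\<Sum>k<n. (\<Sum>l<p. b k l) * (w k)\<^sup>2)"
    using sum_mult_squares_ge[of n _ "\<lambda>k. \<Sum>l<p. b k l", OF row_weight_bounds(1), where x = w] n_pos
    unfolding \<omega>_def by simp
  have "s * (1 - \<epsilon> * (\<zeta> + \<omega>) + ((1 - \<epsilon>) * (\<zeta>\<^sup>2 + \<omega>\<^sup>2) - 2 * \<mu> * \<zeta> * \<omega>) / 4)
      = s - s * (\<epsilon> * \<zeta>) - s * (\<epsilon> * \<omega>)
        + (s * ((1 - \<epsilon>) * \<zeta>\<^sup>2) + s * ((1 - \<epsilon>) * \<omega>\<^sup>2) - 2 * (s * (\<mu> * \<zeta> * \<omega>))) / 4"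
    by (simp add: algebra_simps add_divide_distrib diff_divide_distrib)
  also have "\<dots> \<le> (\<Sum>k<n. \<Sum>l<p. b k l * (1 + (z l + w k) + (z l + w k)\<^sup>2 / 4))"
    unfolding sum_second_order_expansion
    using linear_z linear_w square_z square_w abs_bilinear_form_le[OF z, of w, folded \<zeta>_def \<omega>_def]
    by (simp only: abs_le_iff) argo
  also have "\<dots> \<le> (\<Sum>k<n. \<Sum>l<p. b k l * exp (z l + w k))"
    using ge by (intro sum_mono mult_left_mono exp_ge_quadratic weight_nonneg) auto
  finally show ?thesis .
qed

lemma exp_row_weight_bounds:
  assumes s: "0 < s" and \<epsilon>: "\<epsilon> \<le> 1 / 2" and z: "\<And>l. l < p \<Longrightarrow> \<bar>z l\<bar> \<le> 1 / 2" and k: "k < n"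
  shows "0 < (\<Sum>l<p. b k l * exp (z l))" "(\<Sum>l<p. b k l * exp (z l)) \<le> s / n * exp 1"
proof -
  have exp_z: "exp (- (1 / 2)) \<le> exp (z l)" "exp (z l) \<le> exp (1 / 2)" if "l < p" for l
    using z[OF that] unfolding exp_le_cancel_iff by linarith+
  have "0 < s / n * (1 - \<epsilon>)" using s n_pos \<epsilon> by simp
  then have "0 < (\<Sum>l<p. b k l) * exp (- (1 / 2))" using row_weight_bounds(1)[OF k] by simp
  also have "\<dots> \<le> (\<Sum>l<p. b k l * exp (z l))"
    unfolding sum_distrib_right
    by (intro sum_mono mult_left_mono weight_nonneg exp_z) simp_all
  finally show "0 < (\<Sum>l<p. b k l * exp (z l))" .
  have "(\<Sum>l<p. b k l * exp (z l)) \<le> (\<Sum>l<p. b k l) * exp (1 / 2)"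
    unfolding sum_distrib_right
    by (intro sum_mono mult_left_mono weight_nonneg exp_z) simp_all
  also have "\<dots> \<le> s / n * (1 + \<epsilon>) * exp (1 / 2)"
    by (intro mult_right_mono row_weight_bounds(2) k) simp
  also have "\<dots> \<le> s / n * exp (1 / 2) * exp (1 / 2)"
    using s \<epsilon> exp_ge_add_one_self[of "1 / 2"] by (intro mult_left_mono mult_right_mono) auto
  also have "\<dots> = s / n * exp 1" by (simp flip: exp_add)
  finally show "(\<Sum>l<p. b k l * exp (z l)) \<le> s / n * exp 1" .
qed

lemma row_balancing_exponents:
  assumes s: "0 < s" and \<epsilon>: "\<epsilon> \<le> 1 / 2" and z: "\<And>l. l < p \<Longrightarrow> \<bar>z l\<bar> \<le> 1 / 2"
    and prod: "(\<Prod>k<n. \<Sum>l<p. b k l * exp (z l)) \<le> (s / n) ^ n"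
  obtains w where "\<And>k. k < n \<Longrightarrow> - 1 \<le> w k" and "0 \<le> (\<Sum>k<n. w k)"
    and "\<And>k. k < n \<Longrightarrow> (\<Sum>l<p. b k l * exp (z l + w k)) = s / n"
proof
  define m where "m k = (\<Sum>l<p. b k l * exp (z l))" for k
  have m: "0 < m k" "m k \<le> s / n * exp 1" if "k < n" for k
    unfolding m_def by (rule exp_row_weight_bounds[OF s \<epsilon> z that], assumption)+
  have q: "0 < s / n" using s n_pos by simp
  have ratio: "0 < s / n / m k" if "k < n" for k by (rule divide_pos_pos[OF q m(1)[OF that]])
  show "- 1 \<le> ln (s / n / m k)" if "k < n" for k
  proof -
    have "exp (- 1) * m k \<le> exp (- 1) * (s / n * exp 1)"
      by (intro mult_left_mono m(2) that) simp
    also have "\<dots> = s / n" by (simp add: exp_minus)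
    finally have "exp (- 1) \<le> s / n / m k" unfolding pos_le_divide_eq[OF m(1)[OF that]] .
    then show ?thesis using ratio[OF that] by (simp add: ln_ge_iff)
  qed
  show "0 \<le> (\<Sum>k<n. ln (s / n / m k))"
  proof -
    have "0 < (\<Prod>k<n. m k)" using m(1) by (intro prod_pos) auto
    then have "1 \<le> (s / n) ^ n / (\<Prod>k<n. m k)" using prod unfolding m_def by simp
    also have "\<dots> = (\<Prod>k<n. s / n / m k)" by (simp add: prod_dividef power_divide)
    finally have "0 \<le> ln (\<Prod>k<n. s / n / m k)" by (rule ln_ge_zero)
    also have "\<dots> = (\<Sum>k<n. ln (s / n / m k))" using ratio by (intro ln_prod) force+
    finally show ?thesis .
  qed
  show "(\<Sum>l<p. b k l * exp (z l + ln (s / n / m k))) = s / n" if "k < n" for k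
  proof -
    have "(\<Sum>l<p. b k l * exp (z l + ln (s / n / m k))) = m k * (s / n / m k)"
      using ratio[OF that] unfolding m_def[of k] exp_add sum_distrib_right
      by (simp add: mult.assoc)
    then show ?thesis using m(1)[OF that] by simp
  qed
qed

text \<open>Row balancing makes the total weight equal to \<open>s\<close> again, so the second-order lower bound on the total
  weight turns into an inequality between a positive definite quadratic form and a linear form.\<close>
theorem balancing_exponents_bound:
  assumes s: "0 < s" and \<mu>: "0 \<le> \<mu>" "\<mu> < 1" and \<epsilon>: "0 \<le> \<epsilon>" "\<epsilon> \<le> (1 - \<mu>) / 2"
    and z0: "(\<Sum>l<p. z l) = 0" and z: "\<And>l. l < p \<Longrightarrow> \<bar>z l\<bar> \<le> 1 / 2"
    and prod: "(\<Prod>k<n. \<Sum>l<p. b k l * exp (z l)) \<le> (s / n) ^ n"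
  shows "L2_set z {..<p} \<le> 12 * (\<epsilon> * sqrt p / (1 - \<mu>))"
proof -
  obtain w where w: "\<And>k. k < n \<Longrightarrow> - 1 \<le> w k" and w0: "0 \<le> (\<Sum>k<n. w k)"
    and balanced: "\<And>k. k < n \<Longrightarrow> (\<Sum>l<p. b k l * exp (z l + w k)) = s / n"
    using row_balancing_exponents[of z, OF s _ z prod] \<mu> \<epsilon> by auto
  have ge: "- 2 \<le> z l + w k" if "k < n" "l < p" for k l using w[OF that(1)] z[OF that(2)] by simp
  have total: "(\<Sum>k<n. \<Sum>l<p. b k l * exp (z l + w k)) = s" using balanced n_pos by simp
  define \<zeta> where "\<zeta> = root_mean_square p z"
  define \<omega> where "\<omega> = root_mean_square n w"
  have "s * (1 - \<epsilon> * (\<zeta> + \<omega>) + ((1 - \<epsilon>) * (\<zeta>\<^sup>2 + \<omega>\<^sup>2) - 2 * \<mu> * \<zeta> * \<omega>) / 4) \<le> s * 1"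
    using exp_weight_sum_ge[OF z0 w0 ge] unfolding total \<zeta>_def \<omega>_def by simp
  then have "1 - \<epsilon> * (\<zeta> + \<omega>) + ((1 - \<epsilon>) * (\<zeta>\<^sup>2 + \<omega>\<^sup>2) - 2 * \<mu> * \<zeta> * \<omega>) / 4 \<le> 1"
    using s by (rule mult_left_le_imp_le)
  then have "\<zeta> \<le> 12 * (\<epsilon> / (1 - \<mu>))"
    by (intro expander_quadratic_bound[where \<omega> = \<omega>, OF \<mu> \<epsilon>]) linarith
  then have "sqrt p * \<zeta> \<le> sqrt p * (12 * (\<epsilon> / (1 - \<mu>)))" by (rule mult_left_mono) simp
  then show ?thesis unfolding L2_set_eq_root_mean_square \<zeta>_def by (simp add: mult_ac)
qed

end

section \<open>Frobenius norm, trace and adjoint\<close>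

declare mat_adjoint_adjoint [simp] and assoc_mult_mat [simp del]

lemma mat_mult_assoc_dim:
  fixes A :: "'a :: semiring_0 mat"
  assumes "dim_col A = dim_row B" "dim_col B = dim_row C"
  shows "A * B * C = A * (B * C)"
  using assms by (intro assoc_mult_mat[of A "dim_row A" "dim_row B" B "dim_row C" C "dim_col C"]) auto

lemma index_mult_mat_sum:
  assumes "A \<in> carrier_mat n m" "B \<in> carrier_mat m p" "i < n" "j < p"
  shows "(A * B) $$ (i, j) = (\<Sum>k<m. A $$ (i, k) * B $$ (k, j))"
  using assms by (simp add: scalar_prod_def atLeast0LessThan)

lemma frob_norm_eq_L2_set:
  assumes "A \<in> carrier_mat n m"
  shows "frob_norm A = L2_set (\<lambda>ij. cmod (A $$ ij)) ({..<n} \<times> {..<m})"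
  using assms by (simp add: frob_norm_def L2_set_def sum.cartesian_product split_def)

lemma frob_norm_square:
  assumes "A \<in> carrier_mat n m"
  shows "(frob_norm A)\<^sup>2 = (\<Sum>i<n. \<Sum>j<m. (cmod (A $$ (i, j)))\<^sup>2)"
  using assms by (simp add: frob_norm_eq_L2_set L2_set_square sum.cartesian_product split_def)

lemma frob_norm_nonneg [simp]: "0 \<le> frob_norm A"
  unfolding frob_norm_def by (intro real_sqrt_ge_zero sum_nonneg) auto

lemma cmod_index_le_frob_norm:
  assumes "A \<in> carrier_mat n m" "i < n" "j < m"
  shows "cmod (A $$ (i, j)) \<le> frob_norm A"
  unfolding frob_norm_eq_L2_set[OF assms(1)] using assms by (intro member_le_L2_set) auto

lemma L2_set_diagonal_le_frob_norm:
  assumes A: "A \<in> carrier_mat n n"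
  shows "L2_set (\<lambda>i. cmod (A $$ (i, i))) {..<n} \<le> frob_norm A"
proof (rule power2_le_imp_le)
  show "(L2_set (\<lambda>i. cmod (A $$ (i, i))) {..<n})\<^sup>2 \<le> (frob_norm A)\<^sup>2"
    unfolding L2_set_square frob_norm_square[OF A]
    by (intro sum_mono member_le_sum[of _ _ "\<lambda>j. (cmod (A $$ (_, j)))\<^sup>2"]) auto
qed simp

lemma frob_norm_triangle_ineq:
  assumes A: "A \<in> carrier_mat n m" and B: "B \<in> carrier_mat n m"
  shows "frob_norm (A + B) \<le> frob_norm A + frob_norm B"
proof -
  have "frob_norm (A + B) = L2_set (\<lambda>ij. cmod (A $$ ij + B $$ ij)) ({..<n} \<times> {..<m})"
    unfolding frob_norm_eq_L2_set[OF add_carrier_mat[OF B]] using A B by (intro L2_set_cong) auto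
  also have "\<dots> \<le> L2_set (\<lambda>ij. cmod (A $$ ij) + cmod (B $$ ij)) ({..<n} \<times> {..<m})"
    by (intro L2_set_mono norm_triangle_ineq) auto
  also have "\<dots> \<le> frob_norm A + frob_norm B"
    unfolding frob_norm_eq_L2_set[OF A] frob_norm_eq_L2_set[OF B] by (rule L2_set_triangle_ineq)
  finally show ?thesis .
qed

lemma frob_norm_mult_le:
  assumes A: "A \<in> carrier_mat n m" and B: "B \<in> carrier_mat m p"
  shows "frob_norm (A * B) \<le> frob_norm A * frob_norm B"
proof (rule power2_le_imp_le)
  let ?row = "\<lambda>i. L2_set (\<lambda>k. cmod (A $$ (i, k))) {..<m}"
  let ?col = "\<lambda>j. L2_set (\<lambda>k. cmod (B $$ (k, j))) {..<m}"
  have "(frob_norm (A * B))\<^sup>2 = (\<Sum>i<n. \<Sum>j<p. (cmod (\<Sum>k<m. A $$ (i, k) * B $$ (k, j)))\<^sup>2)"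
    unfolding frob_norm_square[OF mult_carrier_mat[OF A B]]
    by (intro sum.cong refl) (simp only: index_mult_mat_sum[OF A B] lessThan_iff)
  also have "\<dots> \<le> (\<Sum>i<n. \<Sum>j<p. (?row i * ?col j)\<^sup>2)"
    by (intro sum_mono power_mono norm_sum_mult_le_L2_set norm_ge_zero)
  also have "\<dots> = (\<Sum>i<n. (?row i)\<^sup>2) * (\<Sum>j<p. (?col j)\<^sup>2)"
    by (simp add: power_mult_distrib sum_product)
  also have "(\<Sum>j<p. (?col j)\<^sup>2) = (frob_norm B)\<^sup>2"
    unfolding frob_norm_square[OF B] L2_set_square by (rule sum.swap)
  also have "(\<Sum>i<n. (?row i)\<^sup>2) = (frob_norm A)\<^sup>2"
    unfolding frob_norm_square[OF A] L2_set_square ..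
  finally show "(frob_norm (A * B))\<^sup>2 \<le> (frob_norm A * frob_norm B)\<^sup>2"
    by (simp only: power_mult_distrib)
qed simp

lemma mat_trace_mult_commute:
  assumes "A \<in> carrier_mat n m" "B \<in> carrier_mat m n"
  shows "mat_trace (A * B) = mat_trace (B * A)"
proof -
  have "mat_trace (A * B) = (\<Sum>i<n. \<Sum>j<m. A $$ (i, j) * B $$ (j, i))"
    using assms by (simp add: mat_trace_def scalar_prod_def atLeast0LessThan)
  also have "\<dots> = (\<Sum>j<m. \<Sum>i<n. A $$ (i, j) * B $$ (j, i))"
    by (rule sum.swap)
  also have "\<dots> = mat_trace (B * A)"
    using assms by (simp add: mat_trace_def scalar_prod_def atLeast0LessThan mult.commute)
  finally show ?thesis .
qed

lemma mat_trace_add: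
  assumes "A \<in> carrier_mat n n" "B \<in> carrier_mat n n"
  shows "mat_trace (A + B) = mat_trace A + mat_trace B"
  using assms by (simp add: mat_trace_def sum.distrib)

lemma mat_adjoint_one [simp]: "mat_adjoint (1\<^sub>m n) = (1\<^sub>m n :: complex mat)"
  by (rule eq_matI) (auto simp: index_mat_adjoint)

lemma mat_adjoint_add:
  assumes "A \<in> carrier_mat n m" "B \<in> carrier_mat n m"
  shows "mat_adjoint (A + B) = mat_adjoint A + (mat_adjoint B :: complex mat)"
  using assms by (intro eq_matI) (auto simp: index_mat_adjoint)

lemma dim_mat_diag [simp]: "dim_row (mat_diag n d) = n" "dim_col (mat_diag n d) = n"
  by (simp_all add: mat_diag_def)

lemma mat_adjoint_mat_diag: "mat_adjoint (mat_diag n d) = mat_diag n (\<lambda>i. cnj (d i))"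
  by (rule eq_matI) (auto simp: index_mat_adjoint mat_diag_def)

lemma index_diag_sandwich:
  assumes P: "P \<in> carrier_mat m n" and ij: "i < m" "j < m"
  shows "(P * mat_diag n d * mat_adjoint P) $$ (i, j) = (\<Sum>k<n. P $$ (i, k) * d k * cnj (P $$ (j, k)))"
  unfolding mat_diag_mult_right[OF P]
  using carrier_matD[OF P] ij by (simp add: scalar_prod_def atLeast0LessThan index_mat_adjoint)

lemma mat_adjoint_sandwich:
  assumes P: "P \<in> carrier_mat n m" and M: "M \<in> carrier_mat m m"
  shows "mat_adjoint (P * M * mat_adjoint P) = P * mat_adjoint M * mat_adjoint (P :: complex mat)"
  unfolding mat_adjoint_mult[OF mult_carrier_mat[OF P M] mat_adjoint_carrier[OF P]] mat_adjoint_mult[OF P M]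
  using carrier_matD[OF P] carrier_matD[OF M] by (simp add: mat_mult_assoc_dim)

lemma sandwich_sandwich:
  fixes P Q M :: "complex mat"
  assumes "P \<in> carrier_mat a b" "Q \<in> carrier_mat b c" "M \<in> carrier_mat c c"
  shows "P * (Q * M * mat_adjoint Q) * mat_adjoint P = (P * Q) * M * mat_adjoint (P * Q)"
  unfolding mat_adjoint_mult[OF assms(1,2)] using assms
  by (simp add: mat_mult_assoc_dim)

lemma hermitian_sandwich:
  assumes "P \<in> carrier_mat n m" "M \<in> carrier_mat m m" "hermitian_mat M"
  shows "hermitian_mat (P * M * mat_adjoint P)"
  using assms by (simp add: hermitian_mat_def mat_adjoint_sandwich)

lemma index_hermitian:
  assumes "hermitian_mat A" "A \<in> carrier_mat n n" "i < n" "j < n"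
  shows "A $$ (i, j) = cnj (A $$ (j, i))"
  using index_mat_adjoint[of i A j] assms unfolding hermitian_mat_def by simp

lemma frob_norm_mat_adjoint: "frob_norm (mat_adjoint A) = frob_norm A"
proof -
  have "(\<Sum>i<dim_col A. \<Sum>j<dim_row A. (cmod (mat_adjoint A $$ (i, j)))\<^sup>2)
      = (\<Sum>i<dim_col A. \<Sum>j<dim_row A. (cmod (A $$ (j, i)))\<^sup>2)"
    by (intro sum.cong) (auto simp: index_mat_adjoint)
  also have "\<dots> = (\<Sum>j<dim_row A. \<Sum>i<dim_col A. (cmod (A $$ (j, i)))\<^sup>2)" by (rule sum.swap)
  finally show ?thesis unfolding frob_norm_def by simp
qed

lemma index_adjoint_mult_self:
  assumes "A \<in> carrier_mat n m" "j < m"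
  shows "(mat_adjoint A * A) $$ (j, j) = complex_of_real (\<Sum>i<n. (cmod (A $$ (i, j)))\<^sup>2)"
  using assms
  by (simp add: index_mult_mat_sum[OF mat_adjoint_carrier] index_mat_adjoint complex_norm_square
      mult.commute del: index_mult_mat of_real_power)

lemma frob_norm_square_eq_trace:
  assumes A: "A \<in> carrier_mat n m"
  shows "complex_of_real ((frob_norm A)\<^sup>2) = mat_trace (mat_adjoint A * A)"
proof -
  have "mat_trace (mat_adjoint A * A) = (\<Sum>j<m. complex_of_real (\<Sum>i<n. (cmod (A $$ (i, j)))\<^sup>2))"
    unfolding mat_trace_def using A by (intro sum.cong index_adjoint_mult_self[OF A]) auto
  also have "\<dots> = complex_of_real (\<Sum>j<m. \<Sum>i<n. (cmod (A $$ (i, j)))\<^sup>2)" by simp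
  also have "\<dots> = complex_of_real ((frob_norm A)\<^sup>2)"
    unfolding frob_norm_square[OF A] by (subst sum.swap) (rule refl)
  finally show ?thesis by (rule sym)
qed

lemma det_mat_adjoint:
  assumes A: "A \<in> carrier_mat n n"
  shows "det (mat_adjoint A) = cnj (det A)"
proof -
  interpret cnj_hom: comm_ring_hom cnj by unfold_locales auto
  have "mat_adjoint A = map_mat cnj (transpose_mat A)"
    by (rule eq_matI) (use A in \<open>auto simp: index_mat_adjoint\<close>)
  then show ?thesis by (simp only: cnj_hom.hom_det det_transpose[OF A])
qed

lemma det_sandwich:
  assumes P: "P \<in> carrier_mat n n" and M: "M \<in> carrier_mat n n"
  shows "det (P * M * mat_adjoint P) = det P * det M * cnj (det P)"
  by (simp add: det_mult[OF mult_carrier_mat[OF P M] mat_adjoint_carrier[OF P]] det_mult[OF P M]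
      det_mat_adjoint[OF P])

lemma invertible_mat_det_one:
  fixes A :: "'a :: comm_ring_1 mat"
  assumes A: "A \<in> carrier_mat n n" and "det A = 1"
  shows "invertible_mat A"
proof -
  have "A * adj_mat A = 1\<^sub>m n" "adj_mat A * A = 1\<^sub>m n" "adj_mat A \<in> carrier_mat n n"
    using adj_mat[OF A] assms(2) by auto
  then show ?thesis
    using carrier_matD[OF A] unfolding invertible_mat_def inverts_mat_def
    by (intro conjI exI[of _ "adj_mat A"]) simp_all
qed

section \<open>Unitary matrices\<close>

definition unitary_mat :: "nat \<Rightarrow> complex mat \<Rightarrow> bool" where
  "unitary_mat n U \<longleftrightarrow> U \<in> carrier_mat n n \<and> mat_adjoint U * U = 1\<^sub>m n \<and> U * mat_adjoint U = 1\<^sub>m n"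

lemma unitary_matD:
  assumes "unitary_mat n U"
  shows "U \<in> carrier_mat n n" "mat_adjoint U \<in> carrier_mat n n"
    "mat_adjoint U * U = 1\<^sub>m n" "U * mat_adjoint U = 1\<^sub>m n"
  using assms unfolding unitary_mat_def by (auto intro: mat_adjoint_carrier)

lemma unitary_matI:
  assumes U: "U \<in> carrier_mat n n" and "mat_adjoint U * U = 1\<^sub>m n"
  shows "unitary_mat n U"
  using assms mat_mult_left_right_inverse[OF mat_adjoint_carrier[OF U] U]
  unfolding unitary_mat_def by simp

lemma unitary_mat_adjoint: "unitary_mat n U \<Longrightarrow> unitary_mat n (mat_adjoint U)"
  unfolding unitary_mat_def by (auto intro: mat_adjoint_carrier)

lemma unitary_mat_one: "unitary_mat n (1\<^sub>m n)"
  by (rule unitary_matI) auto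

lemma unitary_mult_cancel:
  assumes U: "unitary_mat n U" and M: "dim_row M = n"
  shows "mat_adjoint U * (U * M) = M" "U * (mat_adjoint U * M) = M"
proof -
  note u = unitary_matD[OF U]
  have "mat_adjoint U * (U * M) = (mat_adjoint U * U) * M"
    "U * (mat_adjoint U * M) = (U * mat_adjoint U) * M"
    using carrier_matD[OF u(1)] M by (simp_all add: mat_mult_assoc_dim)
  then show "mat_adjoint U * (U * M) = M" "U * (mat_adjoint U * M) = M"
    unfolding u using M by auto
qed

lemma unitary_mat_mult:
  assumes U: "unitary_mat n U" and V: "unitary_mat n V"
  shows "unitary_mat n (U * V)"
proof (rule unitary_matI)
  note u = unitary_matD[OF U] and v = unitary_matD[OF V]
  show "U * V \<in> carrier_mat n n" using u v by auto
  have "mat_adjoint (U * V) * (U * V) = mat_adjoint V * (mat_adjoint U * (U * V))"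
    unfolding mat_adjoint_mult[OF u(1) v(1)]
    using carrier_matD[OF u(1)] carrier_matD[OF v(1)] by (simp add: mat_mult_assoc_dim)
  then show "mat_adjoint (U * V) * (U * V) = 1\<^sub>m n"
    using carrier_matD[OF v(1)] v(3) by (simp only: unitary_mult_cancel[OF U])
qed

lemma unitary_sandwich_carrier:
  assumes "unitary_mat n U" "M \<in> carrier_mat n n"
  shows "U * M * mat_adjoint U \<in> carrier_mat n n"
  using unitary_matD[OF assms(1)] assms(2) by (metis mult_carrier_mat)

lemma unitary_sandwich_cancel:
  assumes U: "unitary_mat n U" and M: "M \<in> carrier_mat n n"
  shows "mat_adjoint U * (U * M * mat_adjoint U) * U = M"
proof -
  note u = unitary_matD[OF U]
  have "mat_adjoint U * (U * M * mat_adjoint U) * U = mat_adjoint U * (U * (M * (mat_adjoint U * U)))"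
    using carrier_matD[OF u(1)] M by (simp add: mat_mult_assoc_dim)
  also have "\<dots> = M" unfolding u(3) using M by (simp add: unitary_mult_cancel[OF U])
  finally show ?thesis .
qed

lemma frob_norm_unitary_mult:
  assumes U: "unitary_mat n U" and M: "M \<in> carrier_mat n m"
  shows "frob_norm (U * M) = frob_norm M"
proof -
  note u = unitary_matD[OF U]
  have "mat_adjoint (U * M) * (U * M) = mat_adjoint M * (mat_adjoint U * (U * M))"
    unfolding mat_adjoint_mult[OF u(1) M]
    using carrier_matD[OF u(1)] carrier_matD[OF M] by (simp add: mat_mult_assoc_dim)
  also have "\<dots> = mat_adjoint M * M" using carrier_matD[OF M] by (simp only: unitary_mult_cancel[OF U])
  finally have "complex_of_real ((frob_norm (U * M))\<^sup>2) = complex_of_real ((frob_norm M)\<^sup>2)"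
    unfolding frob_norm_square_eq_trace[OF M] frob_norm_square_eq_trace[OF mult_carrier_mat[OF u(1) M]]
    by simp
  then show ?thesis unfolding of_real_eq_iff by simp
qed

lemma frob_norm_unitary_sandwich:
  assumes U: "unitary_mat n U" and M: "M \<in> carrier_mat n n"
  shows "frob_norm (U * M * mat_adjoint U) = frob_norm M"
proof -
  note u = unitary_matD[OF U]
  have UM: "U * M \<in> carrier_mat n n" using u(1) M by simp
  have "frob_norm (U * M * mat_adjoint U) = frob_norm (mat_adjoint (U * M * mat_adjoint U))"
    by (rule frob_norm_mat_adjoint[symmetric])
  also have "mat_adjoint (U * M * mat_adjoint U) = U * mat_adjoint (U * M)"
    by (simp add: mat_adjoint_mult[OF UM u(2)])
  also have "frob_norm \<dots> = frob_norm (U * M)"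
    by (simp only: frob_norm_unitary_mult[OF U mat_adjoint_carrier[OF UM]] frob_norm_mat_adjoint)
  also have "\<dots> = frob_norm M" by (rule frob_norm_unitary_mult[OF U M])
  finally show ?thesis .
qed

lemma mat_trace_unitary_sandwich:
  assumes U: "unitary_mat n U" and M: "M \<in> carrier_mat n n"
  shows "mat_trace (U * M * mat_adjoint U) = mat_trace M"
proof -
  note u = unitary_matD[OF U]
  have "mat_trace (U * M * mat_adjoint U) = mat_trace (mat_adjoint U * (U * M))"
    using u(1,2) M by (intro mat_trace_mult_commute[of _ n n]) auto
  then show ?thesis using unitary_mult_cancel(1)[OF U] carrier_matD[OF M] by simp
qed

lemma det_unitary_sandwich:
  assumes U: "unitary_mat n U" and M: "M \<in> carrier_mat n n"
  shows "det (U * M * mat_adjoint U) = det M"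
proof -
  note u = unitary_matD[OF U]
  have "det U * cnj (det U) = det (U * mat_adjoint U)"
    by (simp only: det_mult[OF u(1,2)] det_mat_adjoint[OF u(1)])
  then have "det U * cnj (det U) = 1" by (simp add: u(4))
  then show ?thesis unfolding det_sandwich[OF u(1) M] by (simp add: mult_ac)
qed

lemma normalize_corthogonal_columns:
  fixes W :: "complex mat"
  assumes W: "W \<in> carrier_mat n n" and orth: "corthogonal_mat W"
  obtains d where "unitary_mat n (W * mat_diag n d)"
proof -
  define N where "N j = (\<Sum>i<n. (cmod (W $$ (i, j)))\<^sup>2)" for j
  define d where "d j = complex_of_real (1 / sqrt (N j))" for j
  have diag: "(mat_adjoint W * W) $$ (j, j) = complex_of_real (N j)" if "j < n" for j
    unfolding N_def by (rule index_adjoint_mult_self[OF W that])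
  have off_diag: "(mat_adjoint W * W) $$ (i, j) = 0" if "i < n" "j < n" "i \<noteq> j" for i j
    using orth W that unfolding corthogonal_mat_def diagonal_mat_def Let_def by auto
  have gram: "mat_adjoint W * W = mat_diag n (\<lambda>j. complex_of_real (N j))"
    by (rule eq_matI) (use W diag off_diag in \<open>auto simp: mat_diag_def simp del: index_mult_mat(1)\<close>)
  have "(mat_adjoint W * W) $$ (j, j) \<noteq> 0" if "j < n" for j
    using orth W that unfolding corthogonal_mat_def Let_def by blast
  then have N: "N j \<noteq> 0" if "j < n" for j using diag that by simp
  have N_nonneg: "0 \<le> N j" for j unfolding N_def by (intro sum_nonneg) simp
  have "mat_adjoint (W * mat_diag n d) * (W * mat_diag n d)
      = mat_diag n (\<lambda>j. cnj (d j)) * (mat_adjoint W * W) * mat_diag n d"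
    using carrier_matD[OF W]
    by (simp add: mat_adjoint_mult[OF W mat_diag_dim] mat_adjoint_mat_diag mat_mult_assoc_dim)
  also have "\<dots> = mat_diag n (\<lambda>j. if N j = 0 then 0 else 1)"
    unfolding gram mat_diag_diag d_def by (simp add: N_nonneg flip: of_real_mult)
  also have "\<dots> = 1\<^sub>m n"
    by (rule eq_matI) (use N in \<open>auto simp: mat_diag_def\<close>)
  finally show thesis
    using W by (intro that[of d] unitary_matI) auto
qed

lemma exists_unitary_first_col:
  fixes v :: "complex vec"
  assumes v: "v \<in> carrier_vec (Suc n)" "v \<noteq> 0\<^sub>v (Suc n)"
  obtains U c where "unitary_mat (Suc n) U" "col U 0 = c \<cdot>\<^sub>v v"
proof -
  interpret cof_vec_space "Suc n" "TYPE(complex)" .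
  define ws where "ws = gram_schmidt (Suc n) (basis_completion v)"
  define W where "W = mat_of_cols (Suc n) ws"
  note basis = basis_completion[OF v]
  note orth = gram_schmidt_result[OF basis(2,4,5) refl, folded ws_def]
  have len: "length ws = Suc n" using orth(4) basis(6) by simp
  have W: "W \<in> carrier_mat (Suc n) (Suc n)" unfolding W_def len[symmetric] by simp
  have col_W: "col W j = ws ! j" if "j < Suc n" for j
    unfolding W_def using that len orth(3) by (auto intro!: col_mat_of_cols)
  have "corthogonal_mat W"
    using orth(2) W len by (intro corthogonal_matI) (auto simp: col_W corthogonalD)
  then obtain d where U: "unitary_mat (Suc n) (W * mat_diag (Suc n) d)"
    by (rule normalize_corthogonal_columns[OF W])
  have "basis_completion v = v # tl (basis_completion v)"
    using basis(6,7) by (cases "basis_completion v") auto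
  then have "hd ws = v" unfolding ws_def using gram_schmidt_hd[OF v(1)] by metis
  then have "col W 0 = v" using col_W[of 0] len by (cases ws) auto
  then have "col (W * mat_diag (Suc n) d) 0 = d 0 \<cdot>\<^sub>v v"
    unfolding mat_diag_mult_right[OF W] using W v by (intro eq_vecI) (auto simp: mult.commute)
  then show thesis by (rule that[OF U])
qed

section \<open>Spectral decomposition\<close>

definition spectral_mat :: "nat \<Rightarrow> complex mat \<Rightarrow> (nat \<Rightarrow> real) \<Rightarrow> complex mat" where
  "spectral_mat n U x = U * mat_diag n (\<lambda>i. complex_of_real (x i)) * mat_adjoint U"

definition scalar_direct_sum :: "complex \<Rightarrow> complex mat \<Rightarrow> complex mat" where
  "scalar_direct_sum c B =
    four_block_mat (mat 1 1 (\<lambda>_. c)) (0\<^sub>m 1 (dim_col B)) (0\<^sub>m (dim_row B) 1) B"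

lemma dim_scalar_direct_sum [simp]:
  "dim_row (scalar_direct_sum c B) = Suc (dim_row B)" "dim_col (scalar_direct_sum c B) = Suc (dim_col B)"
  by (simp_all add: scalar_direct_sum_def)

lemma scalar_direct_sum_carrier:
  "B \<in> carrier_mat n n \<Longrightarrow> scalar_direct_sum c B \<in> carrier_mat (Suc n) (Suc n)"
  by (intro carrier_matI) auto

lemma index_scalar_direct_sum:
  assumes "B \<in> carrier_mat n n" "i < Suc n" "j < Suc n"
  shows "scalar_direct_sum c B $$ (i, j) =
    (case i of 0 \<Rightarrow> (case j of 0 \<Rightarrow> c | Suc j \<Rightarrow> 0) | Suc i \<Rightarrow> (case j of 0 \<Rightarrow> 0 | Suc j \<Rightarrow> B $$ (i, j)))"
  unfolding scalar_direct_sum_def using assms by (auto split: nat.splits)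

lemma mult_scalar_direct_sum:
  assumes B: "B \<in> carrier_mat n n" and C: "C \<in> carrier_mat n n"
  shows "scalar_direct_sum c B * scalar_direct_sum d C = scalar_direct_sum (c * d) (B * C)"
proof -
  have "mat 1 1 (\<lambda>_. c) * mat 1 1 (\<lambda>_. d) = mat 1 1 (\<lambda>_. c * d)"
    by (rule eq_matI) (auto simp: scalar_prod_def)
  then show ?thesis
    unfolding scalar_direct_sum_def using B C
    by (subst mult_four_block_mat[of _ 1 1 _ n _ n _ _ 1 _ n]) auto
qed

lemma mat_adjoint_scalar_direct_sum:
  assumes "B \<in> carrier_mat n n"
  shows "mat_adjoint (scalar_direct_sum c B) = scalar_direct_sum (cnj c) (mat_adjoint B)"
  using assms
  by (intro eq_matI)
    (auto simp: index_mat_adjoint index_scalar_direct_sum[OF assms]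
      index_scalar_direct_sum[OF mat_adjoint_carrier[OF assms]] split: nat.splits)

lemma mat_diag_scalar_direct_sum:
  "scalar_direct_sum c (mat_diag n d) = mat_diag (Suc n) (case_nat c d)"
  by (rule eq_matI)
    (auto simp: scalar_direct_sum_def mat_diag_def split: nat.splits)

lemma unitary_scalar_direct_sum:
  assumes V: "unitary_mat n V"
  shows "unitary_mat (Suc n) (scalar_direct_sum 1 V)"
proof (rule unitary_matI[OF scalar_direct_sum_carrier])
  note v = unitary_matD[OF V]
  have "scalar_direct_sum 1 (1\<^sub>m n) = 1\<^sub>m (Suc n)"
    by (rule eq_matI) (auto simp: scalar_direct_sum_def)
  then show "mat_adjoint (scalar_direct_sum 1 V) * scalar_direct_sum 1 V = 1\<^sub>m (Suc n)"
    by (simp add: mat_adjoint_scalar_direct_sum[OF v(1)] mult_scalar_direct_sum[OF v(2,1)] v(3))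
qed (rule unitary_matD(1)[OF V])

lemma scalar_direct_sum_spectral_mat:
  assumes V: "unitary_mat n V"
  shows "scalar_direct_sum (complex_of_real e) (spectral_mat n V x)
    = spectral_mat (Suc n) (scalar_direct_sum 1 V) (case_nat e x)"
proof -
  note v = unitary_matD[OF V]
  have diag: "(\<lambda>i. complex_of_real (case_nat e x i))
      = case_nat (complex_of_real e) (\<lambda>i. complex_of_real (x i))"
    by (auto split: nat.splits)
  show ?thesis
    unfolding spectral_mat_def diag
    by (simp add: mat_adjoint_scalar_direct_sum[OF v(1)] mult_scalar_direct_sum[OF v(1) mat_diag_dim]
        mult_scalar_direct_sum[OF mult_carrier_mat[OF v(1) mat_diag_dim] v(2)]
        flip: mat_diag_scalar_direct_sum)
qed

lemma col_unitary_conj_eigenvector: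
  assumes A: "A \<in> carrier_mat n n" and U: "unitary_mat n U" and j: "j < n"
    and ev: "A *\<^sub>v col U j = e \<cdot>\<^sub>v col U j"
  shows "col (mat_adjoint U * A * U) j = e \<cdot>\<^sub>v unit_vec n j"
proof -
  note u = unitary_matD[OF U]
  have "col (mat_adjoint U * A * U) j = mat_adjoint U *\<^sub>v (e \<cdot>\<^sub>v col U j)"
    unfolding assoc_mult_mat[OF u(2) A u(1)]
    by (simp add: col_mult2[OF u(2) mult_carrier_mat[OF A u(1)] j] col_mult2[OF A u(1) j] ev)
  also have "\<dots> = e \<cdot>\<^sub>v col (mat_adjoint U * U) j"
    by (simp add: mult_mat_vec[OF u(2) col_carrier_vec[OF j u(1)]] col_mult2[OF u(2,1) j])
  finally show ?thesis unfolding u(3) using j by simp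
qed

lemma hermitian_deflation:
  assumes A: "A \<in> carrier_mat (Suc n) (Suc n)" and herm: "hermitian_mat A"
  obtains U e B where "unitary_mat (Suc n) U" "B \<in> carrier_mat n n" "hermitian_mat B"
    "mat_adjoint U * A * U = scalar_direct_sum (complex_of_real e) B"
proof -
  obtain v e where v: "v \<in> carrier_vec (Suc n)" "v \<noteq> 0\<^sub>v (Suc n)" and ev: "A *\<^sub>v v = e \<cdot>\<^sub>v v"
    using spectrum_non_empty[OF A] A unfolding spectrum_def eigenvalue_def eigenvector_def by auto
  obtain U c where U: "unitary_mat (Suc n) U" and col_U: "col U 0 = c \<cdot>\<^sub>v v"
    by (rule exists_unitary_first_col[OF v])
  note u = unitary_matD[OF U]
  define M where "M = mat_adjoint U * A * U"
  define B where "B = mat n n (\<lambda>(i, j). M $$ (Suc i, Suc j))"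
  have M: "M \<in> carrier_mat (Suc n) (Suc n)" unfolding M_def using u A by auto
  have B: "B \<in> carrier_mat n n" unfolding B_def by simp
  have index_B: "B $$ (i, j) = M $$ (Suc i, Suc j)" if "i < n" "j < n" for i j
    unfolding B_def using that by simp
  have "hermitian_mat M" unfolding M_def using hermitian_sandwich[OF u(2) A herm] by simp
  note M_herm = index_hermitian[OF this M]
  have "A *\<^sub>v col U 0 = e \<cdot>\<^sub>v col U 0"
    unfolding col_U mult_mat_vec[OF A v(1)] ev by (simp add: smult_smult_assoc mult.commute)
  then have col_M: "col M 0 = e \<cdot>\<^sub>v unit_vec (Suc n) 0"
    unfolding M_def by (rule col_unitary_conj_eigenvector[OF A U zero_less_Suc])
  have M_col: "M $$ (i, 0) = (if i = 0 then e else 0)" if "i < Suc n" for i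
    using arg_cong[OF col_M, of "\<lambda>v. v $ i"] M that by simp
  have e: "cnj e = e" using M_herm[of 0 0] M_col[of 0] by simp
  then have e_real: "complex_of_real (Re e) = e" by (simp add: complex_eq_iff)
  have M_row: "M $$ (0, j) = (if j = 0 then e else 0)" if "j < Suc n" for j
    using M_herm[of 0 j] M_col[OF that] that e by simp
  have "hermitian_mat B"
    unfolding hermitian_mat_def
    by (rule eq_matI) (use B in \<open>auto simp: index_B index_mat_adjoint intro: M_herm[symmetric]\<close>)
  moreover have "M = scalar_direct_sum (complex_of_real (Re e)) B"
    by (rule eq_matI)
      (use M B in \<open>auto simp: index_scalar_direct_sum[OF B] e_real M_col M_row index_B split: nat.splits\<close>)
  ultimately show thesis using that[OF U B] unfolding M_def by blast
qed

theorem hermitian_spectral_decomposition: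
  assumes "A \<in> carrier_mat n n" "hermitian_mat A"
  obtains U x where "unitary_mat n U" "A = spectral_mat n U x"
  using assms
proof (induction n arbitrary: A thesis)
  case 0
  have "A = spectral_mat 0 (1\<^sub>m 0) (\<lambda>_. 0)" using 0(2) by (intro eq_matI) (auto simp: spectral_mat_def)
  then show ?case by (rule 0(1)[OF unitary_mat_one])
next
  case (Suc n)
  obtain U e B where U: "unitary_mat (Suc n) U" and B: "B \<in> carrier_mat n n" "hermitian_mat B"
    and deflated: "mat_adjoint U * A * U = scalar_direct_sum (complex_of_real e) B"
    by (rule hermitian_deflation[OF Suc.prems(2,3)])
  obtain V x where V: "unitary_mat n V" and B_eq: "B = spectral_mat n V x"
    by (rule Suc.IH[OF _ B])
  let ?W = "scalar_direct_sum 1 V"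
  note W = unitary_scalar_direct_sum[OF V]
  have "A = U * (mat_adjoint U * A * U) * mat_adjoint U"
    using unitary_sandwich_cancel[OF unitary_mat_adjoint[OF U] Suc.prems(2)] by simp
  also have "\<dots> = U * spectral_mat (Suc n) ?W (case_nat e x) * mat_adjoint U"
    unfolding deflated B_eq scalar_direct_sum_spectral_mat[OF V] ..
  also have "\<dots> = spectral_mat (Suc n) (U * ?W) (case_nat e x)"
    unfolding spectral_mat_def
    by (rule sandwich_sandwich[OF unitary_matD(1)[OF U] unitary_matD(1)[OF W] mat_diag_dim])
  finally show ?case by (rule Suc.prems(1)[OF unitary_mat_mult[OF U W]])
qed

lemma spectral_mat_cong:
  assumes "\<And>i. i < n \<Longrightarrow> x i = y i"
  shows "spectral_mat n U x = spectral_mat n U y"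
proof -
  have "mat_diag n (\<lambda>i. complex_of_real (x i)) = mat_diag n (\<lambda>i. complex_of_real (y i))"
    by (rule eq_matI) (use assms in \<open>auto simp: mat_diag_def\<close>)
  then show ?thesis unfolding spectral_mat_def by simp
qed

context
  fixes n :: nat and U :: "complex mat"
  assumes U: "unitary_mat n U"
begin

lemma spectral_mat_carrier: "spectral_mat n U x \<in> carrier_mat n n"
  unfolding spectral_mat_def by (rule unitary_sandwich_carrier[OF U mat_diag_dim])

lemma dim_spectral_mat [simp]:
  "dim_row (spectral_mat n U x) = n" "dim_col (spectral_mat n U x) = n"
  using carrier_matD[OF spectral_mat_carrier] by auto

lemma index_spectral_mat:
  assumes "i < n" "j < n"
  shows "spectral_mat n U x $$ (i, j) = (\<Sum>k<n. U $$ (i, k) * complex_of_real (x k) * cnj (U $$ (j, k)))"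
  unfolding spectral_mat_def by (rule index_diag_sandwich[OF unitary_matD(1)[OF U] assms])

lemma spectral_mat_one: "spectral_mat n U (\<lambda>_. 1) = 1\<^sub>m n"
  unfolding spectral_mat_def using unitary_matD[OF U] by simp

lemma spectral_mat_const: "spectral_mat n U (\<lambda>_. c) = complex_of_real c \<cdot>\<^sub>m 1\<^sub>m n"
proof (rule eq_matI)
  fix i j assume "i < dim_row (complex_of_real c \<cdot>\<^sub>m 1\<^sub>m n)" "j < dim_col (complex_of_real c \<cdot>\<^sub>m 1\<^sub>m n)"
  then have ij: "i < n" "j < n" by auto
  have "spectral_mat n U (\<lambda>_. c) $$ (i, j) = complex_of_real c * spectral_mat n U (\<lambda>_. 1) $$ (i, j)"
    unfolding index_spectral_mat[OF ij] by (simp add: sum_distrib_left mult_ac)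
  then show "spectral_mat n U (\<lambda>_. c) $$ (i, j) = (complex_of_real c \<cdot>\<^sub>m 1\<^sub>m n) $$ (i, j)"
    using ij by (simp add: spectral_mat_one)
qed simp_all

lemma spectral_mat_minus:
  "spectral_mat n U x - spectral_mat n U y = spectral_mat n U (\<lambda>i. x i - y i)"
proof (rule eq_matI)
  fix i j
  assume "i < dim_row (spectral_mat n U (\<lambda>i. x i - y i))" "j < dim_col (spectral_mat n U (\<lambda>i. x i - y i))"
  then have "i < n" "j < n" by simp_all
  then show "(spectral_mat n U x - spectral_mat n U y) $$ (i, j)
      = spectral_mat n U (\<lambda>i. x i - y i) $$ (i, j)"
    by (simp add: index_spectral_mat right_diff_distrib left_diff_distrib sum_subtractf)
qed simp_all

lemma spectral_mat_mult:
  "spectral_mat n U x * spectral_mat n U y = spectral_mat n U (\<lambda>i. x i * y i)"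
proof -
  note u = carrier_matD[OF unitary_matD(1)[OF U]]
  let ?X = "mat_diag n (\<lambda>i. complex_of_real (x i))" and ?Y = "mat_diag n (\<lambda>i. complex_of_real (y i))"
  have "spectral_mat n U x * spectral_mat n U y = U * (?X * (mat_adjoint U * (U * (?Y * mat_adjoint U))))"
    unfolding spectral_mat_def using u by (simp add: mat_mult_assoc_dim)
  also have "mat_adjoint U * (U * (?Y * mat_adjoint U)) = ?Y * mat_adjoint U"
    by (rule unitary_mult_cancel(1)[OF U]) simp
  also have "U * (?X * (?Y * mat_adjoint U)) = U * (?X * ?Y) * mat_adjoint U"
    using u by (simp add: mat_mult_assoc_dim del: mat_diag_diag)
  finally show ?thesis unfolding mat_diag_diag spectral_mat_def by simp
qed

lemma mat_adjoint_spectral_mat: "mat_adjoint (spectral_mat n U x) = spectral_mat n U x"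
  unfolding spectral_mat_def mat_adjoint_sandwich[OF unitary_matD(1)[OF U] mat_diag_dim]
  by (simp add: mat_adjoint_mat_diag)

lemma hermitian_spectral_mat: "hermitian_mat (spectral_mat n U x)"
  unfolding hermitian_mat_def by (rule mat_adjoint_spectral_mat)

lemma mat_trace_spectral_mat: "mat_trace (spectral_mat n U x) = complex_of_real (\<Sum>i<n. x i)"
  unfolding spectral_mat_def mat_trace_unitary_sandwich[OF U mat_diag_dim]
  by (simp add: mat_trace_def mat_diag_def)

lemma det_spectral_mat: "det (spectral_mat n U x) = complex_of_real (\<Prod>i<n. x i)"
proof -
  let ?D = "mat_diag n (\<lambda>i. complex_of_real (x i))"
  have "det ?D = prod_list (diag_mat ?D)"
    by (rule det_upper_triangular[of _ n]) (auto simp: mat_diag_def upper_triangular_def)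
  also have "\<dots> = (\<Prod>i<n. complex_of_real (x i))"
    unfolding prod_list_diag_prod by (intro prod.cong) (auto simp: mat_diag_def)
  finally show ?thesis unfolding spectral_mat_def det_unitary_sandwich[OF U mat_diag_dim] by simp
qed

lemma frob_norm_spectral_mat: "frob_norm (spectral_mat n U x) = L2_set x {..<n}"
proof -
  have "(\<Sum>j<n. (cmod (if i = j then complex_of_real (x j) else 0))\<^sup>2) = (x i)\<^sup>2" if "i < n" for i
    using that by (simp add: if_distrib[of cmod] if_distrib[of "\<lambda>a. a\<^sup>2"] cong: if_cong)
  then have "frob_norm (mat_diag n (\<lambda>i. complex_of_real (x i))) = L2_set x {..<n}"
    by (simp add: frob_norm_def L2_set_def mat_diag_def)
  then show ?thesis unfolding spectral_mat_def frob_norm_unitary_sandwich[OF U mat_diag_dim] .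
qed

lemma frob_norm_spectral_mat_minus_one:
  "frob_norm (spectral_mat n U x - 1\<^sub>m n) = L2_set (\<lambda>i. x i - 1) {..<n}"
  unfolding spectral_mat_one[symmetric] spectral_mat_minus by (rule frob_norm_spectral_mat)

lemma frob_norm_one_minus_spectral_mat:
  "frob_norm (1\<^sub>m n - spectral_mat n U x) = L2_set (\<lambda>i. x i - 1) {..<n}"
  unfolding spectral_mat_one[symmetric] spectral_mat_minus frob_norm_spectral_mat
  by (simp add: L2_set_def power2_commute)

end

lemma det_spectral_mat_sqrt:
  assumes "unitary_mat n U"
  shows "det (spectral_mat n U (\<lambda>i. sqrt (x i))) = complex_of_real (sqrt (\<Prod>i<n. x i))"
proof -
  have "(\<Prod>i<n. sqrt (x i)) = sqrt (\<Prod>i<n. x i)" by (induction n) (simp_all add: real_sqrt_mult)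
  then show ?thesis unfolding det_spectral_mat[OF assms] by (simp only:)
qed

lemma spectral_mat_sqrt:
  assumes U: "unitary_mat n U" and "\<And>i. i < n \<Longrightarrow> 0 \<le> x i"
  defines "S \<equiv> spectral_mat n U (\<lambda>i. sqrt (x i))"
  shows "mat_adjoint S * S = spectral_mat n U x"
  unfolding S_def mat_adjoint_spectral_mat[OF U] spectral_mat_mult[OF U]
  by (rule spectral_mat_cong) (simp add: assms)

lemma spectral_mat_whitening:
  assumes V: "unitary_mat n V" and m: "\<And>k. k < n \<Longrightarrow> 0 < m k" and g: "0 \<le> g"
  defines "R \<equiv> spectral_mat n V (\<lambda>k. sqrt (g / m k))"
  shows "R * spectral_mat n V m * mat_adjoint R = complex_of_real g \<cdot>\<^sub>m 1\<^sub>m n"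
  unfolding R_def mat_adjoint_spectral_mat[OF V] spectral_mat_mult[OF V] spectral_mat_const[OF V, symmetric]
proof (rule spectral_mat_cong)
  fix k assume "k < n"
  then show "sqrt (g / m k) * m k * sqrt (g / m k) = g"
    using m[of k] g by (simp add: mult.commute[of _ "m k"] mult.assoc less_imp_le)
qed

section \<open>The operator norm\<close>

lemma l2_norm_vec_eq_L2_set: "l2_norm_vec v = L2_set (\<lambda>i. cmod (v $ i)) {..<dim_vec v}"
  by (simp add: l2_norm_vec_def L2_set_def)

lemma mat_of_col_carrier: "mat_of_cols n [v] \<in> carrier_mat n 1"
  by (intro carrier_matI) simp_all

lemma frob_norm_mat_of_col: "frob_norm (mat_of_cols (dim_vec v) [v]) = l2_norm_vec v"
  by (simp add: frob_norm_def l2_norm_vec_def mat_of_cols_Cons_index_0)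

lemma l2_norm_vec_mult_mat_vec:
  assumes A: "A \<in> carrier_mat n m" and v: "v \<in> carrier_vec m"
  shows "l2_norm_vec (A *\<^sub>v v) = frob_norm (A * mat_of_cols m [v])"
proof -
  have "A * mat_of_cols m [v] = mat_of_cols n [A *\<^sub>v v]"
    using A v by (intro eq_matI) (auto simp: mat_of_cols_Cons_index_0)
  then show ?thesis using A frob_norm_mat_of_col[of "A *\<^sub>v v"] by simp
qed

lemma l2_norm_vec_mult_le_frob_norm:
  assumes A: "A \<in> carrier_mat n m" and v: "v \<in> carrier_vec m"
  shows "l2_norm_vec (A *\<^sub>v v) \<le> frob_norm A * l2_norm_vec v"
  using frob_norm_mult_le[OF A mat_of_col_carrier, of v] frob_norm_mat_of_col[of v] v
  by (simp add: l2_norm_vec_mult_mat_vec[OF A v])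

lemma l2_norm_vec_unitary:
  assumes U: "unitary_mat n U" and v: "v \<in> carrier_vec n"
  shows "l2_norm_vec (U *\<^sub>v v) = l2_norm_vec v"
  using frob_norm_unitary_mult[OF U mat_of_col_carrier, of v] frob_norm_mat_of_col[of v] v
  by (simp add: l2_norm_vec_mult_mat_vec[OF unitary_matD(1)[OF U] v])

lemma op_norm_mat_le:
  assumes "\<And>v. v \<in> carrier_vec (dim_col A) \<Longrightarrow> l2_norm_vec v \<le> 1 \<Longrightarrow> l2_norm_vec (A *\<^sub>v v) \<le> B"
  shows "op_norm_mat A \<le> B"
  unfolding op_norm_mat_def
proof (rule cSup_least)
  have "l2_norm_vec (0\<^sub>v (dim_col A)) \<le> 1" by (simp add: l2_norm_vec_def)
  then show "{l2_norm_vec (A *\<^sub>v v) |v. v \<in> carrier_vec (dim_col A) \<and> l2_norm_vec v \<le> 1} \<noteq> {}"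
    using zero_carrier_vec by blast
qed (use assms in blast)

lemma l2_norm_vec_mult_le_op_norm:
  assumes "v \<in> carrier_vec (dim_col A)" "l2_norm_vec v \<le> 1"
  shows "l2_norm_vec (A *\<^sub>v v) \<le> op_norm_mat A"
  unfolding op_norm_mat_def
proof (rule cSup_upper)
  show "bdd_above {l2_norm_vec (A *\<^sub>v v) |v. v \<in> carrier_vec (dim_col A) \<and> l2_norm_vec v \<le> 1}"
  proof (rule bdd_aboveI[of _ "frob_norm A"], clarify)
    fix v assume v: "v \<in> carrier_vec (dim_col A)" "l2_norm_vec v \<le> 1"
    have "l2_norm_vec (A *\<^sub>v v) \<le> frob_norm A * l2_norm_vec v"
      by (rule l2_norm_vec_mult_le_frob_norm[of _ "dim_row A"]) (use v in auto)
    also have "\<dots> \<le> frob_norm A" using v(2) by (intro mult_left_le) auto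
    finally show "l2_norm_vec (A *\<^sub>v v) \<le> frob_norm A" .
  qed
qed (use assms in blast)

lemma frob_norm_mat_diag_mult_le:
  assumes M: "M \<in> carrier_mat n m" and d: "\<And>i. i < n \<Longrightarrow> cmod (d i) \<le> B" and B: "0 \<le> B"
  shows "frob_norm (mat_diag n d * M) \<le> B * frob_norm M"
proof (rule power2_le_imp_le)
  have "(frob_norm (mat_diag n d * M))\<^sup>2 = (\<Sum>i<n. \<Sum>j<m. (cmod (d i) * cmod (M $$ (i, j)))\<^sup>2)"
    unfolding frob_norm_square[OF mult_carrier_mat[OF mat_diag_dim M]]
    unfolding mat_diag_mult_left[OF M] by (simp add: norm_mult)
  also have "\<dots> \<le> (\<Sum>i<n. \<Sum>j<m. (B * cmod (M $$ (i, j)))\<^sup>2)"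
    using d by (intro sum_mono power_mono mult_right_mono) auto
  also have "\<dots> = (B * frob_norm M)\<^sup>2"
    by (simp add: power_mult_distrib frob_norm_square[OF M] sum_distrib_left)
  finally show "(frob_norm (mat_diag n d * M))\<^sup>2 \<le> (B * frob_norm M)\<^sup>2" .
qed (use B in simp)

lemma op_norm_spectral_mat_le:
  assumes U: "unitary_mat n U" and x: "\<And>i. i < n \<Longrightarrow> \<bar>x i\<bar> \<le> B" and B: "0 \<le> B"
  shows "op_norm_mat (spectral_mat n U x) \<le> B"
proof (rule op_norm_mat_le)
  note u = unitary_matD[OF U] and X = spectral_mat_carrier[OF U]
  let ?D = "mat_diag n (\<lambda>i. complex_of_real (x i))"
  fix v assume "v \<in> carrier_vec (dim_col (spectral_mat n U x))" and v1: "l2_norm_vec v \<le> 1"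
  then have v: "v \<in> carrier_vec n" using carrier_matD[OF X] by simp
  have y: "mat_adjoint U *\<^sub>v v \<in> carrier_vec n" using u(2) v by simp
  have "spectral_mat n U x *\<^sub>v v = U *\<^sub>v (?D *\<^sub>v (mat_adjoint U *\<^sub>v v))"
    unfolding spectral_mat_def using u v y by (simp add: assoc_mult_mat_vec[of _ n n _ n])
  then have "l2_norm_vec (spectral_mat n U x *\<^sub>v v) = l2_norm_vec (?D *\<^sub>v (mat_adjoint U *\<^sub>v v))"
    using l2_norm_vec_unitary[OF U mult_mat_vec_carrier[OF mat_diag_dim y]] by simp
  also have "\<dots> = frob_norm (?D * mat_of_cols n [mat_adjoint U *\<^sub>v v])"
    by (rule l2_norm_vec_mult_mat_vec[OF mat_diag_dim y])
  also have "\<dots> \<le> B * frob_norm (mat_of_cols n [mat_adjoint U *\<^sub>v v])"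
    by (rule frob_norm_mat_diag_mult_le[OF mat_of_col_carrier]) (use x B in auto)
  also have "frob_norm (mat_of_cols n [mat_adjoint U *\<^sub>v v]) = l2_norm_vec v"
    using frob_norm_mat_of_col[of "mat_adjoint U *\<^sub>v v"] u(1)
      l2_norm_vec_unitary[OF unitary_mat_adjoint[OF U] v] by simp
  also have "B * l2_norm_vec v \<le> B" using v1 B by (rule mult_left_le)
  finally show "l2_norm_vec (spectral_mat n U x *\<^sub>v v) \<le> B" .
qed

lemma op_norm_minus_self_le: "op_norm_mat (M - M) \<le> 0"
  by (rule op_norm_mat_le) (simp add: l2_norm_vec_def scalar_prod_def)

lemma op_norm_one_minus_spectral_mat_le:
  assumes U: "unitary_mat n U" and x: "\<And>i. i < n \<Longrightarrow> \<bar>x i - 1\<bar> \<le> B" and B: "0 \<le> B"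
  shows "op_norm_mat (1\<^sub>m n - spectral_mat n U x) \<le> B"
  unfolding spectral_mat_one[OF U, symmetric] spectral_mat_minus[OF U]
  by (rule op_norm_spectral_mat_le[OF U _ B]) (use x in \<open>simp add: abs_minus_commute\<close>)

lemma cmod_unitary_sandwich_diag_le_op_norm:
  assumes V: "unitary_mat n V" and M: "M \<in> carrier_mat n n" and k: "k < n"
  shows "cmod ((mat_adjoint V * M * V) $$ (k, k)) \<le> op_norm_mat M"
proof -
  note v = unitary_matD[OF V]
  have col: "col V k \<in> carrier_vec n" by (rule col_carrier_vec[OF k v(1)])
  have "l2_norm_vec (col V k) = 1"
    using index_adjoint_mult_self[OF v(1) k] v k
    by (simp add: l2_norm_vec_def flip: of_real_power of_real_sum)
  then have le: "l2_norm_vec (M *\<^sub>v col V k) \<le> op_norm_mat M"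
    using col M by (intro l2_norm_vec_mult_le_op_norm) auto
  let ?y = "mat_adjoint V *\<^sub>v (M *\<^sub>v col V k)"
  have "(mat_adjoint V * M * V) $$ (k, k) = col (mat_adjoint V * M * V) k $ k" using v M k by simp
  also have "col (mat_adjoint V * M * V) k = ?y"
    unfolding assoc_mult_mat[OF v(2) M v(1)]
    by (simp only: col_mult2[OF v(2) mult_carrier_mat[OF M v(1)] k] col_mult2[OF M v(1) k])
  also have "cmod (?y $ k) \<le> l2_norm_vec ?y"
    unfolding l2_norm_vec_eq_L2_set using k v(2)
    by (intro member_le_L2_set[of "{..<dim_vec ?y}" k "\<lambda>i. cmod (?y $ i)"]) auto
  also have "\<dots> = l2_norm_vec (M *\<^sub>v col V k)"
    using M col by (intro l2_norm_vec_unitary[OF unitary_mat_adjoint[OF V]]) auto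
  also note le
  finally show ?thesis .
qed

section \<open>Completely positive maps in unitary bases\<close>

lemma kraus_repD:
  assumes "kraus_rep p n \<Phi> As"
  shows "set As \<subseteq> carrier_mat n p" "\<And>X. X \<in> carrier_mat p p \<Longrightarrow> \<Phi> X = kraus_map n As X"
  using assms unfolding kraus_rep_def by blast+

lemma kraus_map_carrier [simp]: "kraus_map n As X \<in> carrier_mat n n"
  by (simp add: kraus_map_def)

lemma kraus_map_Nil: "kraus_map n [] X = 0\<^sub>m n n"
  by (rule eq_matI) (simp_all add: kraus_map_def)

lemma kraus_map_Cons:
  assumes "A \<in> carrier_mat n p" "X \<in> carrier_mat p p"
  shows "kraus_map n (A # As) X = A * X * mat_adjoint A + kraus_map n As X"
  using assms by (intro eq_matI) (auto simp: kraus_map_def)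

lemma kraus_dual_eq_kraus_map: "kraus_dual p As Y = kraus_map p (map mat_adjoint As) Y"
  unfolding kraus_dual_def kraus_map_def by (simp add: comp_def)

lemma adjoint_kraus_carrier:
  "set As \<subseteq> carrier_mat n p \<Longrightarrow> set (map mat_adjoint As) \<subseteq> carrier_mat p n"
  using mat_adjoint_carrier by auto

lemma kraus_dual_carrier [simp]: "kraus_dual p As Y \<in> carrier_mat p p"
  by (simp add: kraus_dual_def)

lemma hermitian_kraus_map:
  assumes "set As \<subseteq> carrier_mat n p" and X: "X \<in> carrier_mat p p" "hermitian_mat X"
  shows "hermitian_mat (kraus_map n As X)"
  using assms(1)
proof (induction As)
  case Nil
  show ?case unfolding kraus_map_Nil hermitian_mat_def by (rule eq_matI) (auto simp: index_mat_adjoint)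
next
  case (Cons A As)
  then have A: "A \<in> carrier_mat n p" by simp
  have "A * X * mat_adjoint A \<in> carrier_mat n n" using A X by (intro carrier_matI) auto
  then show ?case
    using Cons hermitian_sandwich[OF A X] unfolding kraus_map_Cons[OF A X(1)] hermitian_mat_def
    by (simp add: mat_adjoint_add[of _ n n])
qed

lemma mat_trace_kraus_map:
  assumes "set As \<subseteq> carrier_mat n p" and X: "X \<in> carrier_mat p p"
  shows "mat_trace (kraus_map n As X) = mat_trace (kraus_dual p As (1\<^sub>m n) * X)"
  using assms(1)
proof (induction As)
  case Nil
  then show ?case using X by (simp add: kraus_dual_eq_kraus_map kraus_map_Nil mat_trace_def)
next
  case (Cons A As)
  then have A: "A \<in> carrier_mat n p" by simp
  note A' = mat_adjoint_carrier[OF A]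
  have AA: "mat_adjoint A * A \<in> carrier_mat p p" by (rule mult_carrier_mat[OF A' A])
  have AXA: "A * X * mat_adjoint A \<in> carrier_mat n n"
    by (rule mult_carrier_mat[OF mult_carrier_mat[OF A X] A'])
  have "kraus_dual p (A # As) (1\<^sub>m n) = mat_adjoint A * A + kraus_dual p As (1\<^sub>m n)"
    unfolding kraus_dual_eq_kraus_map list.map kraus_map_Cons[OF A' one_carrier_mat]
      right_mult_one_mat[OF A'] by simp
  then have "mat_trace (kraus_dual p (A # As) (1\<^sub>m n) * X)
      = mat_trace (mat_adjoint A * A * X) + mat_trace (kraus_dual p As (1\<^sub>m n) * X)"
    using X mat_trace_add[OF mult_carrier_mat[OF AA X] mult_carrier_mat[OF kraus_dual_carrier X]]
    by (simp add: add_mult_distrib_mat[OF AA kraus_dual_carrier X])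
  also have "mat_trace (mat_adjoint A * A * X) = mat_trace (A * X * mat_adjoint A)"
    using mat_trace_mult_commute[OF A' mult_carrier_mat[OF A X]] assoc_mult_mat[OF A' A X] by simp
  also have "\<dots> + mat_trace (kraus_dual p As (1\<^sub>m n) * X) = mat_trace (kraus_map n (A # As) X)"
    unfolding kraus_map_Cons[OF A X] using Cons by (simp add: mat_trace_add[OF AXA kraus_map_carrier])
  finally show ?case by (rule sym)
qed

definition kraus_weight :: "complex mat \<Rightarrow> complex mat \<Rightarrow> complex mat list \<Rightarrow> nat \<Rightarrow> nat \<Rightarrow> real" where
  "kraus_weight U V As k l = (\<Sum>A\<leftarrow>As. (cmod ((mat_adjoint V * A * U) $$ (k, l)))\<^sup>2)"

lemma kraus_weight_nonneg: "0 \<le> kraus_weight U V As k l"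
  unfolding kraus_weight_def by (intro sum_list_nonneg) auto

lemma kraus_weight_adjoint:
  assumes "set As \<subseteq> carrier_mat n p" "U \<in> carrier_mat p p" "V \<in> carrier_mat n n" "k < n" "l < p"
  shows "kraus_weight V U (map mat_adjoint As) l k = kraus_weight U V As k l"
proof -
  have "cmod ((mat_adjoint U * mat_adjoint A * V) $$ (l, k)) = cmod ((mat_adjoint V * A * U) $$ (k, l))"
    if "A \<in> set As" for A
  proof -
    have A: "A \<in> carrier_mat n p" using assms(1) that by auto
    have P: "mat_adjoint V * A \<in> carrier_mat n p" using A mat_adjoint_carrier[OF assms(3)] by simp
    have "mat_adjoint U * mat_adjoint A * V = mat_adjoint (mat_adjoint V * A * U)"
      unfolding mat_adjoint_mult[OF P assms(2)] mat_adjoint_mult[OF mat_adjoint_carrier[OF assms(3)] A]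
      using A assms(2,3) by (simp add: mat_mult_assoc_dim)
    then show ?thesis using A assms(2-5) by (simp add: index_mat_adjoint del: index_mult_mat(1))
  qed
  then show ?thesis
    unfolding kraus_weight_def map_map comp_def by (intro arg_cong[where f = sum_list] map_cong) auto
qed

lemma index_unitary_conj_kraus_operator:
  assumes A: "A \<in> carrier_mat n p" and U: "unitary_mat p U" and V: "unitary_mat n V" and k: "k < n"
  shows "(mat_adjoint V * (A * spectral_mat p U x * mat_adjoint A) * V) $$ (k, k)
    = complex_of_real (\<Sum>l<p. (cmod ((mat_adjoint V * A * U) $$ (k, l)))\<^sup>2 * x l)"
proof -
  note u = unitary_matD[OF U] and v = unitary_matD[OF V]
  let ?D = "mat_diag p (\<lambda>l. complex_of_real (x l))" and ?P = "mat_adjoint V * A * U"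
  have VA: "mat_adjoint V * A \<in> carrier_mat n p" by (rule mult_carrier_mat[OF v(2) A])
  have P: "?P \<in> carrier_mat n p" by (rule mult_carrier_mat[OF VA u(1)])
  have "mat_adjoint V * (A * spectral_mat p U x * mat_adjoint A) * V = ?P * ?D * mat_adjoint ?P"
    unfolding spectral_mat_def mat_adjoint_mult[OF VA u(1)] mat_adjoint_mult[OF v(2) A]
    using carrier_matD[OF A] carrier_matD[OF u(1)] carrier_matD[OF v(1)]
    by (simp add: mat_mult_assoc_dim)
  then have "(mat_adjoint V * (A * spectral_mat p U x * mat_adjoint A) * V) $$ (k, k)
      = (\<Sum>l<p. ?P $$ (k, l) * complex_of_real (x l) * cnj (?P $$ (k, l)))"
    by (simp only: index_diag_sandwich[OF P k k])
  also have "\<dots> = complex_of_real (\<Sum>l<p. (cmod (?P $$ (k, l)))\<^sup>2 * x l)"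
    unfolding of_real_sum of_real_mult complex_norm_square by (intro sum.cong refl) (simp only: mult_ac)
  finally show ?thesis .
qed

context
  fixes n p :: nat and As :: "complex mat list" and U V :: "complex mat"
  assumes As: "set As \<subseteq> carrier_mat n p" and U: "unitary_mat p U" and V: "unitary_mat n V"
begin

lemma index_kraus_map_spectral_mat:
  assumes k: "k < n"
  shows "(mat_adjoint V * kraus_map n As (spectral_mat p U x) * V) $$ (k, k)
    = complex_of_real (\<Sum>l<p. kraus_weight U V As k l * x l)"
  using As
proof (induction As)
  case Nil
  then show ?case
    using k unitary_matD[OF V] by (simp add: kraus_map_Nil kraus_weight_def left_mult_zero_mat[of _ n n])
next
  case (Cons A As)
  then have A: "A \<in> carrier_mat n p" by simp
  note v = unitary_matD[OF V] and X = spectral_mat_carrier[OF U]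
  have AXA: "A * spectral_mat p U x * mat_adjoint A \<in> carrier_mat n n"
    by (rule mult_carrier_mat[OF mult_carrier_mat[OF A X] mat_adjoint_carrier[OF A]])
  have VAXA: "mat_adjoint V * (A * spectral_mat p U x * mat_adjoint A) \<in> carrier_mat n n"
    and VK: "mat_adjoint V * kraus_map n As (spectral_mat p U x) \<in> carrier_mat n n"
    by (rule mult_carrier_mat[OF v(2) AXA], rule mult_carrier_mat[OF v(2) kraus_map_carrier])
  have "mat_adjoint V * kraus_map n (A # As) (spectral_mat p U x) * V
      = mat_adjoint V * (A * spectral_mat p U x * mat_adjoint A) * V
        + mat_adjoint V * kraus_map n As (spectral_mat p U x) * V"
    unfolding kraus_map_Cons[OF A X] mult_add_distrib_mat[OF v(2) AXA kraus_map_carrier]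
    by (rule add_mult_distrib_mat[OF VAXA VK v(1)])
  then have "(mat_adjoint V * kraus_map n (A # As) (spectral_mat p U x) * V) $$ (k, k)
      = complex_of_real (\<Sum>l<p. (cmod ((mat_adjoint V * A * U) $$ (k, l)))\<^sup>2 * x l)
        + (mat_adjoint V * kraus_map n As (spectral_mat p U x) * V) $$ (k, k)"
    using k carrier_matD[OF v(1)]
    by (simp add: index_unitary_conj_kraus_operator[OF A U V k] del: index_mult_mat(1))
  also have "\<dots> = complex_of_real (\<Sum>l<p. kraus_weight U V (A # As) k l * x l)"
    using Cons by (simp add: kraus_weight_def distrib_right sum.distrib)
  finally show ?case .
qed

lemma kraus_map_spectral_eigenvalues:
  assumes eq: "kraus_map n As (spectral_mat p U x) = spectral_mat n V m" and k: "k < n"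
  shows "m k = (\<Sum>l<p. kraus_weight U V As k l * x l)"
proof -
  have "mat_adjoint V * spectral_mat n V m * V = mat_diag n (\<lambda>k. complex_of_real (m k))"
    unfolding spectral_mat_def by (rule unitary_sandwich_cancel[OF V mat_diag_dim])
  then have "complex_of_real (m k) = (mat_adjoint V * kraus_map n As (spectral_mat p U x) * V) $$ (k, k)"
    unfolding eq using k by (simp add: mat_diag_def)
  then show ?thesis unfolding index_kraus_map_spectral_mat[OF k] of_real_eq_iff .
qed

end

lemma index_kraus_dual_spectral_mat:
  assumes As: "set As \<subseteq> carrier_mat n p" and U: "unitary_mat p U" and V: "unitary_mat n V" and l: "l < p"
  shows "(mat_adjoint U * kraus_dual p As (spectral_mat n V y) * U) $$ (l, l)
    = complex_of_real (\<Sum>k<n. kraus_weight U V As k l * y k)"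
  unfolding kraus_dual_eq_kraus_map index_kraus_map_spectral_mat[OF adjoint_kraus_carrier[OF As] V U l]
  using kraus_weight_adjoint[OF As unitary_matD(1)[OF U] unitary_matD(1)[OF V] _ l] by simp

lemma det_kraus_map_le_trace:
  assumes As: "set As \<subseteq> carrier_mat n p" and n: "0 < n" and U: "unitary_mat p U"
    and x: "\<And>l. l < p \<Longrightarrow> 0 \<le> x l"
  defines "K \<equiv> kraus_map n As (spectral_mat p U x)"
  shows "0 \<le> Re (mat_trace K)" "Re (det K) \<le> (Re (mat_trace K) / n) ^ n"
proof -
  have "K \<in> carrier_mat n n" "hermitian_mat K"
    unfolding K_def
    using hermitian_kraus_map[OF As spectral_mat_carrier[OF U] hermitian_spectral_mat[OF U]] by auto
  then obtain V m where V: "unitary_mat n V" and K: "K = spectral_mat n V m"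
    by (rule hermitian_spectral_decomposition)
  have m: "0 \<le> m k" if "k < n" for k
    unfolding kraus_map_spectral_eigenvalues[OF As U V K[unfolded K_def] that]
    using x by (intro sum_nonneg mult_nonneg_nonneg kraus_weight_nonneg) auto
  show "0 \<le> Re (mat_trace K)" unfolding K mat_trace_spectral_mat[OF V] using m by (auto intro: sum_nonneg)
  show "Re (det K) \<le> (Re (mat_trace K) / n) ^ n"
    unfolding K mat_trace_spectral_mat[OF V] det_spectral_mat[OF V]
    using prod_le_mean_power[of "{..<n}" m] n m
    by (simp add: lessThan_empty_iff del: of_real_sum of_real_prod)
qed

section \<open>Quantum expanders\<close>

lemma unitary_sandwich_minus_scalar:
  assumes V: "unitary_mat n V" and M: "M \<in> carrier_mat n n"
  shows "mat_adjoint V * (M - c \<cdot>\<^sub>m 1\<^sub>m n) * V = mat_adjoint V * M * V - c \<cdot>\<^sub>m 1\<^sub>m n"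
proof -
  note v = unitary_matD[OF V]
  have scalar: "c \<cdot>\<^sub>m 1\<^sub>m n \<in> carrier_mat n n" by simp
  have "mat_adjoint V * (M - c \<cdot>\<^sub>m 1\<^sub>m n) = mat_adjoint V * M - c \<cdot>\<^sub>m mat_adjoint V"
    unfolding mult_minus_distrib_mat[OF v(2) M scalar] mult_smult_distrib[OF v(2) one_carrier_mat]
      right_mult_one_mat[OF v(2)] ..
  also have "\<dots> * V = mat_adjoint V * M * V - c \<cdot>\<^sub>m (mat_adjoint V * V)"
    unfolding minus_mult_distrib_mat[OF mult_carrier_mat[OF v(2) M] smult_carrier_mat[OF v(2)] v(1)]
      mult_smult_assoc_mat[OF v(2,1)] ..
  finally show ?thesis unfolding v(3) .
qed

lemma abs_unitary_diag_minus_le_op_norm: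
  assumes V: "unitary_mat n V" and M: "M \<in> carrier_mat n n" and k: "k < n"
    and r: "(mat_adjoint V * M * V) $$ (k, k) = complex_of_real r"
  shows "\<bar>r - c\<bar> \<le> op_norm_mat (M - complex_of_real c \<cdot>\<^sub>m 1\<^sub>m n)"
proof -
  have "(mat_adjoint V * (M - complex_of_real c \<cdot>\<^sub>m 1\<^sub>m n) * V) $$ (k, k) = complex_of_real (r - c)"
    unfolding unitary_sandwich_minus_scalar[OF V M] using k r by simp
  then show ?thesis
    using cmod_unitary_sandwich_diag_le_op_norm[OF V _ k, of "M - complex_of_real c \<cdot>\<^sub>m 1\<^sub>m n"]
    by (metis minus_carrier_mat norm_of_real one_carrier_mat smult_carrier_mat)
qed

context
  fixes p n :: nat and \<Phi> :: "complex mat \<Rightarrow> complex mat"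
    and As :: "complex mat list" and U V :: "complex mat"
  assumes rep: "kraus_rep p n \<Phi> As" and U: "unitary_mat p U" and V: "unitary_mat n V"
begin

lemma index_map_one:
  assumes "k < n"
  shows "(mat_adjoint V * \<Phi> (1\<^sub>m p) * V) $$ (k, k) = complex_of_real (\<Sum>l<p. kraus_weight U V As k l)"
  unfolding kraus_repD(2)[OF rep one_carrier_mat]
  using index_kraus_map_spectral_mat[OF kraus_repD(1)[OF rep] U V assms, of "\<lambda>_. 1"]
  by (simp add: spectral_mat_one[OF U])

lemma index_dual_map_one:
  assumes "l < p"
  shows "(mat_adjoint U * dual_map p n \<Phi> (1\<^sub>m n) * U) $$ (l, l)
    = complex_of_real (\<Sum>k<n. kraus_weight U V As k l)"
  using index_kraus_dual_spectral_mat[OF kraus_repD(1)[OF rep] U V assms, of "\<lambda>_. 1"]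
  by (simp add: spectral_mat_one[OF V] dual_map_eq[OF rep one_carrier_mat])

lemma sum_kraus_weight: "(\<Sum>k<n. \<Sum>l<p. kraus_weight U V As k l) = map_size p \<Phi>"
proof -
  have "\<Phi> (1\<^sub>m p) \<in> carrier_mat n n" using rep unfolding kraus_rep_def by simp
  then have "mat_trace (\<Phi> (1\<^sub>m p)) = mat_trace (mat_adjoint V * \<Phi> (1\<^sub>m p) * V)"
    using mat_trace_unitary_sandwich[OF unitary_mat_adjoint[OF V]] by simp
  also have "\<dots> = (\<Sum>k<n. complex_of_real (\<Sum>l<p. kraus_weight U V As k l))"
    unfolding mat_trace_def using carrier_matD[OF unitary_matD(1)[OF V]]
    by (intro sum.cong index_map_one) auto
  finally show ?thesis unfolding map_size_def by simp
qed

lemma L2_set_kraus_weight_le: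
  "L2_set (\<lambda>k. \<Sum>l<p. kraus_weight U V As k l * z l) {..<n} \<le> frob_norm (\<Phi> (spectral_mat p U z))"
proof -
  note V' = unitary_mat_adjoint[OF V]
  let ?M = "mat_adjoint V * \<Phi> (spectral_mat p U z) * V"
  note eq = kraus_repD(2)[OF rep spectral_mat_carrier[OF U]]
  have \<Phi>: "\<Phi> (spectral_mat p U z) \<in> carrier_mat n n" unfolding eq by simp
  have M: "?M \<in> carrier_mat n n" using unitary_sandwich_carrier[OF V' \<Phi>] by simp
  have "L2_set (\<lambda>k. \<Sum>l<p. kraus_weight U V As k l * z l) {..<n}
      = L2_set (\<lambda>k. \<bar>\<Sum>l<p. kraus_weight U V As k l * z l\<bar>) {..<n}"
    by (rule L2_set_abs[symmetric])
  also have "\<dots> = L2_set (\<lambda>k. cmod (?M $$ (k, k))) {..<n}"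
    by (intro L2_set_cong refl)
      (simp only: eq index_kraus_map_spectral_mat[OF kraus_repD(1)[OF rep] U V]
        lessThan_iff norm_of_real)
  also have "\<dots> \<le> frob_norm ?M" by (rule L2_set_diagonal_le_frob_norm[OF M])
  also have "\<dots> = frob_norm (\<Phi> (spectral_mat p U z))" using frob_norm_unitary_sandwich[OF V' \<Phi>] by simp
  finally show ?thesis .
qed

theorem quantum_expander_imp_weight_expander:
  assumes exp: "quantum_expander p n \<epsilon> \<mu> \<Phi>" and "0 < p" "0 < n"
  shows "weight_expander n p (kraus_weight U V As) (map_size p \<Phi>) \<epsilon> \<mu>"
proof
  let ?s = "map_size p \<Phi>"
  have row: "op_norm_mat (\<Phi> (1\<^sub>m p) - complex_of_real (?s / n) \<cdot>\<^sub>m 1\<^sub>m n) \<le> ?s * \<epsilon> / n"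
    and col: "op_norm_mat (dual_map p n \<Phi> (1\<^sub>m n) - complex_of_real (?s / p) \<cdot>\<^sub>m 1\<^sub>m p) \<le> ?s * \<epsilon> / p"
    using exp unfolding quantum_expander_def eps_doubly_balanced_def by blast+
  have carrier: "\<Phi> (1\<^sub>m p) \<in> carrier_mat n n" "dual_map p n \<Phi> (1\<^sub>m n) \<in> carrier_mat p p"
    using rep dual_map_eq[OF rep one_carrier_mat] unfolding kraus_rep_def by simp_all
  show "\<bar>(\<Sum>l<p. kraus_weight U V As k l) - ?s / n\<bar> \<le> ?s * \<epsilon> / n" if "k < n" for k
    using abs_unitary_diag_minus_le_op_norm[OF V carrier(1) that index_map_one[OF that]] row
    by (rule order_trans)
  show "\<bar>(\<Sum>k<n. kraus_weight U V As k l) - ?s / p\<bar> \<le> ?s * \<epsilon> / p" if "l < p" for l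
    using abs_unitary_diag_minus_le_op_norm[OF U carrier(2) that index_dual_map_one[OF that]] col
    by (rule order_trans)
  show "L2_set (\<lambda>k. \<Sum>l<p. kraus_weight U V As k l * z l) {..<n}
      \<le> \<mu> * (?s / sqrt (real n * real p)) * L2_set z {..<p}" if z: "(\<Sum>l<p. z l) = 0" for z
  proof -
    have "mat_trace (spectral_mat p U z) = 0" unfolding mat_trace_spectral_mat[OF U] z by simp
    then have "frob_norm (\<Phi> (spectral_mat p U z))
        \<le> \<mu> * (?s / sqrt (real n * real p)) * frob_norm (spectral_mat p U z)"
      using exp spectral_mat_carrier[OF U] hermitian_spectral_mat[OF U]
      unfolding quantum_expander_def by blast
    with L2_set_kraus_weight_le show ?thesis unfolding frob_norm_spectral_mat[OF U] by (rule order_trans)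
  qed
qed (use assms kraus_weight_nonneg sum_kraus_weight in auto)

end

section \<open>Hermitian matrices of determinant one near the identity\<close>

definition herm_det_ball :: "nat \<Rightarrow> real \<Rightarrow> complex mat set" where
  "herm_det_ball p \<delta> =
    {X \<in> carrier_mat p p. hermitian_mat X \<and> det X = 1 \<and> frob_norm (X - 1\<^sub>m p) \<le> \<delta>}"

lemma spectral_mat_in_herm_det_ball_iff:
  assumes U: "unitary_mat p U"
  shows "spectral_mat p U x \<in> herm_det_ball p \<delta> \<longleftrightarrow> (\<Prod>l<p. x l) = 1 \<and> L2_set (\<lambda>l. x l - 1) {..<p} \<le> \<delta>"
  unfolding herm_det_ball_def frob_norm_spectral_mat_minus_one[OF U, symmetric]
  using spectral_mat_carrier[OF U] hermitian_spectral_mat[OF U]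
  by (simp add: det_spectral_mat[OF U] del: of_real_prod)

lemma one_in_herm_det_ball: "0 \<le> \<delta> \<Longrightarrow> 1\<^sub>m p \<in> herm_det_ball p \<delta>"
  using spectral_mat_in_herm_det_ball_iff[OF unitary_mat_one, of p "\<lambda>_. 1" \<delta>]
  by (simp add: spectral_mat_one[OF unitary_mat_one] L2_set_def)

lemma herm_det_ball_sandwich:
  assumes L: "L \<in> carrier_mat p p" "det L = 1" and less: "frob_norm (mat_adjoint L * L - 1\<^sub>m p) < \<delta>"
  obtains \<eta> where "0 < \<eta>" "\<And>X. X \<in> herm_det_ball p \<eta> \<Longrightarrow> mat_adjoint L * X * L \<in> herm_det_ball p \<delta>"
proof
  note L' = mat_adjoint_carrier[OF L(1)]
  let ?\<gamma> = "frob_norm (mat_adjoint L * L - 1\<^sub>m p)"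
  let ?\<eta> = "(\<delta> - ?\<gamma>) / ((frob_norm L)\<^sup>2 + 1)"
  have pos: "0 < (frob_norm L)\<^sup>2 + 1" by (rule add_nonneg_pos) auto
  then show \<eta>: "0 < ?\<eta>" using less by simp
  fix X assume "X \<in> herm_det_ball p ?\<eta>"
  then have X: "X \<in> carrier_mat p p" "hermitian_mat X" "det X = 1" "frob_norm (X - 1\<^sub>m p) \<le> ?\<eta>"
    unfolding herm_det_ball_def by auto
  have diff: "X - 1\<^sub>m p \<in> carrier_mat p p" by (rule minus_carrier_mat) simp
  have LXL: "mat_adjoint L * X * L \<in> carrier_mat p p"
    by (rule mult_carrier_mat[OF mult_carrier_mat[OF L' X(1)] L(1)])
  have L_diff: "mat_adjoint L * (X - 1\<^sub>m p) \<in> carrier_mat p p" by (rule mult_carrier_mat[OF L' diff])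
  have "mat_adjoint L * (X - 1\<^sub>m p) * L = mat_adjoint L * X * L - mat_adjoint L * L"
    unfolding mult_minus_distrib_mat[OF L' X(1) one_carrier_mat] right_mult_one_mat[OF L']
    by (rule minus_mult_distrib_mat[OF mult_carrier_mat[OF L' X(1)] L' L(1)])
  then have "mat_adjoint L * X * L - 1\<^sub>m p = mat_adjoint L * (X - 1\<^sub>m p) * L + (mat_adjoint L * L - 1\<^sub>m p)"
    using LXL mult_carrier_mat[OF L' L(1)]
    by (intro eq_matI) (auto simp del: index_mult_mat(1))
  then have "frob_norm (mat_adjoint L * X * L - 1\<^sub>m p) \<le> frob_norm (mat_adjoint L * (X - 1\<^sub>m p) * L) + ?\<gamma>"
    using frob_norm_triangle_ineq[OF mult_carrier_mat[OF L_diff L(1)], of "mat_adjoint L * L - 1\<^sub>m p"]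
    by (metis minus_carrier_mat one_carrier_mat)
  also have "frob_norm (mat_adjoint L * (X - 1\<^sub>m p) * L)
      \<le> frob_norm (mat_adjoint L * (X - 1\<^sub>m p)) * frob_norm L"
    by (rule frob_norm_mult_le[OF L_diff L(1)])
  also have "\<dots> \<le> frob_norm L * frob_norm (X - 1\<^sub>m p) * frob_norm L"
    using frob_norm_mult_le[OF L' diff] unfolding frob_norm_mat_adjoint by (rule mult_right_mono) simp
  also have "\<dots> = (frob_norm L)\<^sup>2 * frob_norm (X - 1\<^sub>m p)" by (simp add: power2_eq_square)
  also have "\<dots> \<le> ((frob_norm L)\<^sup>2 + 1) * ?\<eta>" using X(4) \<eta> by (intro mult_mono) auto
  also have "\<dots> = \<delta> - ?\<gamma>" using pos by simp
  finally have "frob_norm (mat_adjoint L * X * L - 1\<^sub>m p) \<le> \<delta>" by simp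
  moreover have "hermitian_mat (mat_adjoint L * X * L)" using hermitian_sandwich[OF L' X(1,2)] by simp
  moreover have "det (mat_adjoint L * X * L) = 1"
    using det_sandwich[OF L' X(1)] det_mat_adjoint[OF L(1)] X(3) L(2) by simp
  ultimately show "mat_adjoint L * X * L \<in> herm_det_ball p \<delta>" unfolding herm_det_ball_def using LXL by simp
qed

lemma continuous_on_det:
  fixes M :: "'a :: topological_space \<Rightarrow> 'b :: real_normed_field mat"
  assumes M: "\<And>x. M x \<in> carrier_mat n n"
    and cont: "\<And>i j. i < n \<Longrightarrow> j < n \<Longrightarrow> continuous_on S (\<lambda>x. M x $$ (i, j))"
  shows "continuous_on S (\<lambda>x. det (M x))"
proof -
  have perm: "\<pi> i < n" if "\<pi> permutes {0..<n}" "i < n" for \<pi> i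
    using permutes_in_image[OF that(1), of i] that(2) by simp
  have "continuous_on S (\<lambda>x. \<Sum>\<pi> | \<pi> permutes {0..<n}. signof \<pi> * (\<Prod>i = 0..<n. M x $$ (i, \<pi> i)))"
    by (intro continuous_intros cont) (auto simp: perm)
  then show ?thesis unfolding det_def'[OF M] .
qed

lemma continuous_on_sum_list:
  fixes f :: "'b \<Rightarrow> 'a :: topological_space \<Rightarrow> 'c :: topological_monoid_add"
  assumes "\<And>y. y \<in> set ys \<Longrightarrow> continuous_on S (f y)"
  shows "continuous_on S (\<lambda>x. \<Sum>y\<leftarrow>ys. f y x)"
  using assms by (induction ys) (auto intro!: continuous_intros)

lemma continuous_on_index_kraus_map:
  assumes As: "set As \<subseteq> carrier_mat n p" and ij: "i < n" "j < n"
    and M: "\<And>x. M x \<in> carrier_mat p p"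
    and cont: "\<And>k l. k < p \<Longrightarrow> l < p \<Longrightarrow> continuous_on S (\<lambda>x. M x $$ (k, l))"
  shows "continuous_on S (\<lambda>x. kraus_map n As (M x) $$ (i, j))"
proof -
  have "continuous_on S (\<lambda>x. (A * M x * mat_adjoint A) $$ (i, j))" if "A \<in> set As" for A
  proof -
    have A: "A \<in> carrier_mat n p" using As that by auto
    show ?thesis
      unfolding index_sandwich[OF A M mat_adjoint_carrier[OF A] ij]
      by (intro continuous_intros cont) auto
  qed
  then have "continuous_on S (\<lambda>x. \<Sum>A\<leftarrow>As. (A * M x * mat_adjoint A) $$ (i, j))"
    by (rule continuous_on_sum_list)
  then show ?thesis unfolding kraus_map_def using ij by simp
qed

lemma continuous_on_frob_norm:
  assumes M: "\<And>x. M x \<in> carrier_mat n m"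
    and cont: "\<And>i j. i < n \<Longrightarrow> j < m \<Longrightarrow> continuous_on S (\<lambda>x. M x $$ (i, j))"
  shows "continuous_on S (\<lambda>x. frob_norm (M x))"
  unfolding frob_norm_def carrier_matD[OF M] by (intro continuous_intros cont) auto

lemma compact_PiE_UNIV:
  assumes "\<And>i. compact (S i)"
  shows "compact (PiE UNIV S)"
proof -
  have "compactin (product_topology (\<lambda>_. euclidean) UNIV) (PiE UNIV S)"
    unfolding compactin_PiE using assms by simp
  then show ?thesis by (simp add: euclidean_product_topology)
qed

lemma cmod_index_herm_det_ball_le:
  assumes "X \<in> herm_det_ball p \<delta>" "i < p" "j < p"
  shows "cmod (X $$ (i, j)) \<le> \<delta> + 1"
proof -
  have X: "X \<in> carrier_mat p p" and le: "frob_norm (X - 1\<^sub>m p) \<le> \<delta>"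
    using assms(1) unfolding herm_det_ball_def by auto
  have "X $$ (i, j) = (X - 1\<^sub>m p) $$ (i, j) + 1\<^sub>m p $$ (i, j)" using X assms(2,3) by simp
  moreover have "cmod ((X - 1\<^sub>m p) $$ (i, j)) \<le> \<delta>"
    using cmod_index_le_frob_norm[OF minus_carrier_mat[OF one_carrier_mat] assms(2,3)] le
    by (rule order_trans)
  moreover have "cmod (1\<^sub>m p $$ (i, j)) \<le> 1" using assms(2,3) by simp
  ultimately show ?thesis by (metis add_mono norm_triangle_le)
qed

lemma closed_herm_det_ball_coefficients: "closed {f. mat p p f \<in> herm_det_ball p \<delta>}"
proof -
  have coeff: "continuous_on UNIV (\<lambda>f. (mat p p f :: complex mat) $$ (i, j))" if "i < p" "j < p" for i j
    using that continuous_on_product_coordinates[of "(i, j)"] by simp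
  have "continuous_on UNIV (\<lambda>f. frob_norm (mat p p f - 1\<^sub>m p))"
  proof (rule continuous_on_frob_norm)
    show "continuous_on UNIV (\<lambda>f. (mat p p f - 1\<^sub>m p :: complex mat) $$ (i, j))" if "i < p" "j < p" for i j
      using that by (simp add: continuous_on_diff)
  qed (simp add: minus_carrier_mat)
  then have frob: "closed {f. frob_norm (mat p p f - 1\<^sub>m p) \<le> \<delta>}"
    by (intro closed_Collect_le continuous_intros)
  have det: "closed {f. det (mat p p f :: complex mat) = 1}"
    by (intro closed_Collect_eq continuous_on_det[of _ p] coeff continuous_intros) simp_all
  have "hermitian_mat (mat p p f) \<longleftrightarrow> (\<forall>i\<in>{..<p}. \<forall>j\<in>{..<p}. cnj (f (j, i)) = f (i, j))" for f
    unfolding hermitian_mat_def mat_eq_iff by (auto simp: index_mat_adjoint)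
  then have "{f. mat p p f \<in> herm_det_ball p \<delta>}
      = (\<Inter>i\<in>{..<p}. \<Inter>j\<in>{..<p}. {f. cnj (f (j, i)) = f (i, j)})
        \<inter> {f. det (mat p p f) = 1} \<inter> {f. frob_norm (mat p p f - 1\<^sub>m p) \<le> \<delta>}"
    unfolding herm_det_ball_def by auto
  also have "closed \<dots>"
    by (intro closed_Int closed_INT ballI det frob closed_Collect_eq continuous_intros
        continuous_on_product_coordinates)
  finally show ?thesis .
qed

lemma herm_det_ball_attains_inf:
  fixes F :: "complex mat \<Rightarrow> real"
  assumes cont: "continuous_on UNIV (\<lambda>f. F (mat p p f))" and \<delta>: "0 \<le> \<delta>"
  obtains X where "X \<in> herm_det_ball p \<delta>" "\<And>Y. Y \<in> herm_det_ball p \<delta> \<Longrightarrow> F X \<le> F Y"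
proof -
  define S where "S ij = (if ij \<in> {..<p} \<times> {..<p} then cball 0 (\<delta> + 1) else {0 :: complex})" for ij
  define C where "C = PiE UNIV S \<inter> {f. mat p p f \<in> herm_det_ball p \<delta>}"
  have "compact C"
    unfolding C_def
    by (intro compact_Int_closed compact_PiE_UNIV closed_herm_det_ball_coefficients) (simp add: S_def)
  have coefficients: "\<exists>f\<in>C. X = mat p p f" if X: "X \<in> herm_det_ball p \<delta>" for X
  proof
    define f where "f ij = (if ij \<in> {..<p} \<times> {..<p} then X $$ ij else 0)" for ij
    show X_eq: "X = mat p p f"
      by (rule eq_matI) (use X in \<open>auto simp: f_def herm_det_ball_def\<close>)
    have "f \<in> PiE UNIV S" using cmod_index_herm_det_ball_le[OF X] by (auto simp: S_def f_def)
    with X show "f \<in> C" unfolding C_def X_eq by blast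
  qed
  then have "C \<noteq> {}" using one_in_herm_det_ball[OF \<delta>] by blast
  then obtain f where "f \<in> C" "\<And>g. g \<in> C \<Longrightarrow> F (mat p p f) \<le> F (mat p p g)"
    using continuous_attains_inf[OF \<open>compact C\<close> _ continuous_on_subset[OF cont]] by blast
  then show thesis using that[of "mat p p f"] coefficients unfolding C_def by blast
qed

corollary det_kraus_map_attains_inf:
  assumes As: "set As \<subseteq> carrier_mat n p" and \<delta>: "0 \<le> \<delta>"
  obtains X where "X \<in> herm_det_ball p \<delta>"
    "\<And>Y. Y \<in> herm_det_ball p \<delta> \<Longrightarrow> Re (det (kraus_map n As X)) \<le> Re (det (kraus_map n As Y))"
proof -
  have "continuous_on UNIV (\<lambda>f. Re (det (kraus_map n As (mat p p f))))"
    by (intro continuous_on_Re continuous_on_det[of _ n] continuous_on_index_kraus_map[OF As])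
      (use continuous_on_product_coordinates in auto)
  from herm_det_ball_attains_inf[OF this \<delta>] that show thesis by blast
qed

section \<open>First-order optimality\<close>

definition tilt :: "nat \<Rightarrow> nat \<Rightarrow> real \<Rightarrow> nat \<Rightarrow> real" where
  "tilt a b t l = (if l = a then t else if l = b then 1 / t else 1)"

context
  fixes a b p :: nat
  assumes ab: "a < p" "b < p" "a \<noteq> b"
begin

lemma prod_tilt:
  assumes "t \<noteq> 0"
  shows "(\<Prod>l<p. tilt a b t l) = 1"
proof -
  have "(\<Prod>l<p. tilt a b t l) = (\<Prod>l\<in>{a, b}. tilt a b t l)"
    using ab by (intro prod.mono_neutral_right) (auto simp: tilt_def)
  then show ?thesis using ab assms by (simp add: tilt_def)
qed

lemma sum_mult_tilt: "(\<Sum>l<p. c l * tilt a b t l) = (\<Sum>l<p. c l) + (t - 1) * c a + (1 / t - 1) * c b"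
proof -
  have "(\<Sum>l<p. c l * tilt a b t l) - (\<Sum>l<p. c l) = (\<Sum>l<p. c l * (tilt a b t l - 1))"
    by (simp add: right_diff_distrib sum_subtractf)
  also have "\<dots> = (\<Sum>l\<in>{a, b}. c l * (tilt a b t l - 1))"
    using ab by (intro sum.mono_neutral_right) (auto simp: tilt_def)
  also have "\<dots> = (t - 1) * c a + (1 / t - 1) * c b" using ab by (simp add: tilt_def)
  finally show ?thesis by simp
qed

lemma L2_set_tilt_minus_one_le:
  assumes "1 \<le> t"
  shows "L2_set (\<lambda>l. tilt a b t l - 1) {..<p} \<le> 2 * (t - 1)"
proof -
  have "1 - 1 / t \<le> t - 1"
    using assms zero_le_power2[of "t - 1"] by (simp add: field_simps power2_eq_square)
  moreover have "1 / t \<le> 1" using assms by simp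
  moreover have "(\<Sum>l<p. \<bar>tilt a b t l - 1\<bar>) = (\<Sum>l\<in>{a, b}. \<bar>tilt a b t l - 1\<bar>)"
    using ab by (intro sum.mono_neutral_right) (auto simp: tilt_def)
  ultimately have "(\<Sum>l<p. \<bar>tilt a b t l - 1\<bar>) \<le> 2 * (t - 1)" using ab assms by (simp add: tilt_def)
  with L2_set_le_sum_abs show ?thesis by (rule order_trans)
qed

lemma coefficient_le_of_tilt:
  assumes \<eta>: "0 < \<eta>"
    and le: "\<And>t. 1 < t \<Longrightarrow> t < 1 + \<eta> \<Longrightarrow> (\<Sum>l<p. c l) \<le> (\<Sum>l<p. c l * tilt a b t l)"
  shows "c b \<le> c a"
proof (rule tendsto_lowerbound)
  show "((\<lambda>t. c a * t) \<longlongrightarrow> c a) (at_right 1)" by (rule tendsto_eq_intros refl)+ simp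
  have "c b \<le> c a * t" if t: "1 < t" "t < 1 + \<eta>" for t
  proof -
    have "0 \<le> (t - 1) * (c a - c b / t)"
      using le[OF t] t unfolding sum_mult_tilt by (simp add: field_simps)
    then have "c b / t \<le> c a" using t by (simp add: zero_le_mult_iff)
    then show ?thesis using t by (simp add: field_simps)
  qed
  moreover have "\<forall>\<^sub>F t in at_right (1 :: real). t \<in> {1<..<1 + \<eta>}"
    using \<eta> by (intro eventually_at_right_real) simp
  ultimately show "\<forall>\<^sub>F t in at_right 1. c b \<le> c a * t" by (auto elim: eventually_mono)
qed simp

end

lemma mat_trace_map_spectral_mat:
  assumes rep: "kraus_rep p n \<Phi> As" and U: "unitary_mat p U"
    and dual: "dual_map p n \<Phi> (1\<^sub>m n) = spectral_mat p U c"
  shows "mat_trace (\<Phi> (spectral_mat p U x)) = complex_of_real (\<Sum>l<p. c l * x l)"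
proof -
  note X = spectral_mat_carrier[OF U, of x]
  have "mat_trace (\<Phi> (spectral_mat p U x)) = mat_trace (dual_map p n \<Phi> (1\<^sub>m n) * spectral_mat p U x)"
    unfolding kraus_repD(2)[OF rep X] dual_map_eq[OF rep one_carrier_mat]
    by (rule mat_trace_kraus_map[OF kraus_repD(1)[OF rep] X])
  then show ?thesis unfolding dual spectral_mat_mult[OF U] mat_trace_spectral_mat[OF U] .
qed

lemma hermitian_dual_map_one:
  assumes rep: "kraus_rep p n \<Phi> As"
  shows "hermitian_mat (dual_map p n \<Phi> (1\<^sub>m n))"
  unfolding dual_map_eq[OF rep one_carrier_mat] kraus_dual_eq_kraus_map
  by (rule hermitian_kraus_map[OF adjoint_kraus_carrier[OF kraus_repD(1)[OF rep]]])
    (simp_all add: hermitian_mat_def)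

lemma doubly_balanced_if_scalar:
  assumes n: "0 < n" and one: "\<Phi> (1\<^sub>m p) = complex_of_real g \<cdot>\<^sub>m 1\<^sub>m n"
    and dual: "dual_map p n \<Phi> (1\<^sub>m n) = complex_of_real (n * g / p) \<cdot>\<^sub>m 1\<^sub>m p"
  shows "doubly_balanced p n \<Phi>"
proof -
  have size: "map_size p \<Phi> = n * g" unfolding map_size_def one by (simp add: mat_trace_def)
  show ?thesis
    unfolding doubly_balanced_def eps_doubly_balanced_def size one dual
    using n op_norm_minus_self_le by simp
qed

text \<open>If two eigenvalues of the dual at the identity differ, tilting the corresponding eigendirections lowers
  the trace of the map to first order, hence by the AM-GM inequality its determinant.\<close>
theorem doubly_balanced_if_local_minimum:
  assumes rep: "kraus_rep p n \<Phi> As" and p: "0 < p" and n: "0 < n"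
    and one: "\<Phi> (1\<^sub>m p) = complex_of_real g \<cdot>\<^sub>m 1\<^sub>m n" and g: "0 < g" and \<eta>: "0 < \<eta>"
    and min: "\<And>X. X \<in> herm_det_ball p \<eta> \<Longrightarrow> g ^ n \<le> Re (det (\<Phi> X))"
  shows "doubly_balanced p n \<Phi>"
proof -
  have carrier: "dual_map p n \<Phi> (1\<^sub>m n) \<in> carrier_mat p p" by (simp add: dual_map_eq[OF rep])
  obtain U c where U: "unitary_mat p U" and dual: "dual_map p n \<Phi> (1\<^sub>m n) = spectral_mat p U c"
    by (rule hermitian_spectral_decomposition[OF carrier hermitian_dual_map_one[OF rep]])
  note trace = mat_trace_map_spectral_mat[OF rep U dual]
  have "complex_of_real (\<Sum>l<p. c l) = complex_of_real (n * g)"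
    using trace[of "\<lambda>_. 1"] unfolding spectral_mat_one[OF U] one by (simp add: mat_trace_def)
  then have sum_c: "(\<Sum>l<p. c l) = n * g" unfolding of_real_eq_iff .
  have le: "c b \<le> c a" if ab: "a < p" "b < p" "a \<noteq> b" for a b
  proof (rule coefficient_le_of_tilt[OF ab])
    show "0 < \<eta> / 2" using \<eta> by simp
    fix t :: real assume t: "1 < t" "t < 1 + \<eta> / 2"
    let ?X = "spectral_mat p U (tilt a b t)"
    have "?X \<in> herm_det_ball p \<eta>"
      using prod_tilt[OF ab, of t] L2_set_tilt_minus_one_le[OF ab, of t] t
      by (simp add: spectral_mat_in_herm_det_ball_iff[OF U])
    then have "g ^ n \<le> Re (det (\<Phi> ?X))" by (rule min)
    moreover have nonneg: "0 \<le> tilt a b t l" for l using t by (simp add: tilt_def)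
    note det_kraus_map_le_trace[OF kraus_repD(1)[OF rep] n U, of "tilt a b t", OF nonneg,
        folded kraus_repD(2)[OF rep spectral_mat_carrier[OF U]], unfolded trace Re_complex_of_real]
    ultimately have "0 \<le> (\<Sum>l<p. c l * tilt a b t l)" "g ^ n \<le> ((\<Sum>l<p. c l * tilt a b t l) / n) ^ n" by auto
    then have "g \<le> (\<Sum>l<p. c l * tilt a b t l) / n"
      using n g by (intro power_mono_iff[THEN iffD1, of g _ n]) auto
    then show "(\<Sum>l<p. c l) \<le> (\<Sum>l<p. c l * tilt a b t l)" unfolding sum_c using n by (simp add: field_simps)
  qed
  have "c l = n * g / p" if l: "l < p" for l
  proof -
    have "c i = c l" if "i < p" for i using le[of i l] le[of l i] that l by (cases "i = l") auto
    then have "(\<Sum>i<p. c i) = p * c l" by simp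
    then show ?thesis using sum_c p by (simp add: field_simps)
  qed
  then have "dual_map p n \<Phi> (1\<^sub>m n) = complex_of_real (n * g / p) \<cdot>\<^sub>m 1\<^sub>m p"
    unfolding dual spectral_mat_const[OF U, symmetric] by (rule spectral_mat_cong)
  then show ?thesis by (rule doubly_balanced_if_scalar[where \<Phi> = \<Phi>, OF n one])
qed

theorem scaling_factors_at_minimum:
  assumes rep: "kraus_rep p n \<Phi> As" and p: "0 < p" and n: "0 < n"
    and U: "unitary_mat p U" and V: "unitary_mat n V"
    and eq: "\<Phi> (spectral_mat p U x) = spectral_mat n V m"
    and x: "(\<Prod>l<p. x l) = 1" "L2_set (\<lambda>l. x l - 1) {..<p} < \<delta>" and \<delta>: "\<delta> \<le> 1"
    and m: "\<And>k. k < n \<Longrightarrow> 0 < m k" and g: "0 < g" "g ^ n = (\<Prod>k<n. m k)"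
    and min: "\<And>Y. Y \<in> herm_det_ball p \<delta> \<Longrightarrow> g ^ n \<le> Re (det (\<Phi> Y))"
  defines "L \<equiv> spectral_mat p U (\<lambda>l. sqrt (x l))" and "R \<equiv> spectral_mat n V (\<lambda>k. sqrt (g / m k))"
  shows "mat_adjoint L * L = spectral_mat p U x" "mat_adjoint R * R = spectral_mat n V (\<lambda>k. g / m k)"
    "det L = 1" "det R = 1" "doubly_balanced p n (scaling \<Phi> L R)"
proof -
  note L = spectral_mat_carrier[OF U, of "\<lambda>l. sqrt (x l)", folded L_def]
  note R = spectral_mat_carrier[OF V, of "\<lambda>k. sqrt (g / m k)", folded R_def]
  have x_pos: "0 < x l" if "l < p" for l
    using abs_le_L2_set[of "{..<p}" l "\<lambda>l. x l - 1"] x(2) \<delta> that by simp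
  show LL: "mat_adjoint L * L = spectral_mat p U x"
    unfolding L_def by (rule spectral_mat_sqrt[OF U]) (simp add: x_pos less_imp_le)
  show "mat_adjoint R * R = spectral_mat n V (\<lambda>k. g / m k)"
    unfolding R_def by (rule spectral_mat_sqrt[OF V]) (simp add: m g(1) less_imp_le)
  show detL: "det L = 1" unfolding L_def det_spectral_mat_sqrt[OF U] x(1) by simp
  show detR: "det R = 1"
    unfolding R_def det_spectral_mat_sqrt[OF V] prod_dividef using g by (simp flip: g(2))
  have "frob_norm (mat_adjoint L * L - 1\<^sub>m p) < \<delta>"
    unfolding LL frob_norm_spectral_mat_minus_one[OF U] by (rule x(2))
  then obtain \<eta> where \<eta>: "0 < \<eta>"
    and ball: "\<And>X. X \<in> herm_det_ball p \<eta> \<Longrightarrow> mat_adjoint L * X * L \<in> herm_det_ball p \<delta>"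
    by (rule herm_det_ball_sandwich[OF L detL]) blast
  show "doubly_balanced p n (scaling \<Phi> L R)"
  proof (rule doubly_balanced_if_local_minimum[OF kraus_rep_scaling[OF rep L R] p n _ g(1) \<eta>])
    show "scaling \<Phi> L R (1\<^sub>m p) = complex_of_real g \<cdot>\<^sub>m 1\<^sub>m n"
      unfolding scaling_def right_mult_one_mat[OF mat_adjoint_carrier[OF L]] LL eq
      using spectral_mat_whitening[OF V m] g(1) unfolding R_def by simp
    fix X assume X: "X \<in> herm_det_ball p \<eta>"
    then have "mat_adjoint L * X * L \<in> carrier_mat p p" using ball unfolding herm_det_ball_def by blast
    then have "det (scaling \<Phi> L R X) = det (\<Phi> (mat_adjoint L * X * L))"
      unfolding scaling_def by (simp add: kraus_repD(2)[OF rep] det_sandwich[OF R] detR)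
    then show "g ^ n \<le> Re (det (scaling \<Phi> L R X))" using min[OF ball[OF X]] by simp
  qed
qed

section \<open>Locating the minimum\<close>

lemma det_map_one_le_size:
  assumes rep: "kraus_rep p n \<Phi> As" and n: "0 < n"
  shows "Re (det (\<Phi> (1\<^sub>m p))) \<le> (map_size p \<Phi> / n) ^ n"
  using det_kraus_map_le_trace(2)[OF kraus_repD(1)[OF rep] n unitary_mat_one, of "\<lambda>_. 1"]
  by (simp add: spectral_mat_one[OF unitary_mat_one] map_size_def flip: kraus_repD(2)[OF rep])

theorem det_minimizer_close_to_one:
  assumes rep: "kraus_rep p n \<Phi> As" and exp: "quantum_expander p n \<epsilon> \<mu> \<Phi>"
    and p: "0 < p" and n: "0 < n" and s: "0 < map_size p \<Phi>"
    and \<mu>: "0 \<le> \<mu>" "\<mu> < 1" and \<epsilon>: "0 \<le> \<epsilon>" "\<epsilon> \<le> (1 - \<mu>) / 2"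
    and U: "unitary_mat p U" and V: "unitary_mat n V"
    and eq: "\<Phi> (spectral_mat p U x) = spectral_mat n V m"
    and ball: "spectral_mat p U x \<in> herm_det_ball p (1 / 3)"
    and le: "Re (det (\<Phi> (spectral_mat p U x))) \<le> Re (det (\<Phi> (1\<^sub>m p)))"
  shows "L2_set (\<lambda>l. x l - 1) {..<p} \<le> 24 * (\<epsilon> * sqrt p / (1 - \<mu>))"
proof -
  interpret weight_expander n p "kraus_weight U V As" "map_size p \<Phi>" \<epsilon> \<mu>
    by (rule quantum_expander_imp_weight_expander[OF rep U V exp p n])
  have prod_x: "(\<Prod>l<p. x l) = 1" and L2_x: "L2_set (\<lambda>l. x l - 1) {..<p} \<le> 1 / 3"
    using ball unfolding spectral_mat_in_herm_det_ball_iff[OF U] by auto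
  have x: "\<bar>x l - 1\<bar> \<le> 1 / 3" if "l < p" for l
    using abs_le_L2_set[of "{..<p}" l "\<lambda>l. x l - 1"] L2_x that by simp
  have x_pos: "0 < x l" if "l < p" for l using x[OF that] by linarith
  have "(\<Sum>l<p. ln (x l)) = ln (\<Prod>l<p. x l)" using x_pos by (intro ln_prod[symmetric]) force+
  then have sum_ln: "(\<Sum>l<p. ln (x l)) = 0" unfolding prod_x by simp
  have "(\<Prod>k<n. \<Sum>l<p. kraus_weight U V As k l * exp (ln (x l))) = (\<Prod>k<n. m k)"
    using kraus_map_spectral_eigenvalues[OF kraus_repD(1)[OF rep] U V
        eq[unfolded kraus_repD(2)[OF rep spectral_mat_carrier[OF U]]]] x_pos by simp
  also have "\<dots> = Re (det (\<Phi> (spectral_mat p U x)))"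
    unfolding eq det_spectral_mat[OF V] by (simp only: Re_complex_of_real)
  also have "\<dots> \<le> (map_size p \<Phi> / n) ^ n" using le det_map_one_le_size[OF rep n] by (rule order_trans)
  finally have ln_bound: "L2_set (\<lambda>l. ln (x l)) {..<p} \<le> 12 * (\<epsilon> * sqrt p / (1 - \<mu>))"
    using abs_ln_bounds(2) x by (intro balancing_exponents_bound[OF s \<mu> \<epsilon> sum_ln]) auto
  have "L2_set (\<lambda>l. x l - 1) {..<p} = L2_set (\<lambda>l. \<bar>x l - 1\<bar>) {..<p}" by (simp only: L2_set_abs)
  also have "\<dots> \<le> L2_set (\<lambda>l. 2 * \<bar>ln (x l)\<bar>) {..<p}"
    using abs_ln_bounds(1) x by (intro L2_set_mono) auto
  also have "\<dots> = 2 * L2_set (\<lambda>l. ln (x l)) {..<p}"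
    by (simp add: L2_set_abs flip: L2_set_right_distrib)
  finally show ?thesis using ln_bound by simp
qed

lemma det_minimizer_spectral:
  assumes rep: "kraus_rep p n \<Phi> As" and \<delta>: "0 \<le> \<delta>"
  obtains U x V m where "unitary_mat p U" "unitary_mat n V" "\<Phi> (spectral_mat p U x) = spectral_mat n V m"
    "spectral_mat p U x \<in> herm_det_ball p \<delta>"
    "\<And>Y. Y \<in> herm_det_ball p \<delta> \<Longrightarrow> (\<Prod>k<n. m k) \<le> Re (det (\<Phi> Y))"
proof -
  note As = kraus_repD(1)[OF rep] and \<Phi> = kraus_repD(2)[OF rep]
  obtain X where X: "X \<in> herm_det_ball p \<delta>"
    and min: "\<And>Y. Y \<in> herm_det_ball p \<delta> \<Longrightarrow> Re (det (kraus_map n As X)) \<le> Re (det (kraus_map n As Y))"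
    by (rule det_kraus_map_attains_inf[OF As \<delta>]) blast
  then have X_herm: "X \<in> carrier_mat p p" "hermitian_mat X" unfolding herm_det_ball_def by auto
  then obtain U x where U: "unitary_mat p U" and X_eq: "X = spectral_mat p U x"
    by (rule hermitian_spectral_decomposition)
  obtain V m where V: "unitary_mat n V" and eq: "kraus_map n As X = spectral_mat n V m"
    by (rule hermitian_spectral_decomposition[OF kraus_map_carrier hermitian_kraus_map[OF As X_herm]])
  have "\<Phi> (spectral_mat p U x) = spectral_mat n V m" using eq X_herm(1) unfolding X_eq by (simp add: \<Phi>)
  moreover have "(\<Prod>k<n. m k) \<le> Re (det (\<Phi> Y))" if Y: "Y \<in> herm_det_ball p \<delta>" for Y
  proof -
    have "Y \<in> carrier_mat p p" using Y unfolding herm_det_ball_def by blast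
    then show ?thesis
      using min[OF Y] unfolding eq det_spectral_mat[OF V] by (simp only: \<Phi> Re_complex_of_real)
  qed
  ultimately show thesis using that[OF U V] X unfolding X_eq by blast
qed

lemma expander_parameters_small:
  fixes \<epsilon> lam :: real
  assumes p: "0 < p" and \<epsilon>: "0 \<le> \<epsilon>" and lam: "0 < lam" "lam \<le> 1"
    and small: "\<epsilon> * sqrt (real p) / lam \<le> 1 / 100"
  shows "\<epsilon> \<le> lam / 2" "\<epsilon> \<le> \<epsilon> * sqrt p / lam"
proof -
  have "\<epsilon> * 1 \<le> \<epsilon> * sqrt p" using \<epsilon> p by (intro mult_left_mono) auto
  then show "\<epsilon> \<le> lam / 2" using small lam by (simp add: pos_divide_le_eq)
  have "\<epsilon> * sqrt p / 1 \<le> \<epsilon> * sqrt p / lam" using lam \<epsilon> by (intro divide_left_mono) auto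
  then show "\<epsilon> \<le> \<epsilon> * sqrt p / lam" using \<open>\<epsilon> * 1 \<le> \<epsilon> * sqrt p\<close> by simp
qed

lemma expander_map_eigenvalue_bounds:
  assumes rep: "kraus_rep p n \<Phi> As" and exp: "quantum_expander p n \<epsilon> \<mu> \<Phi>" and p: "0 < p" and n: "0 < n"
    and U: "unitary_mat p U" and V: "unitary_mat n V" and eq: "\<Phi> (spectral_mat p U x) = spectral_mat n V m"
    and close: "L2_set (\<lambda>l. x l - 1) {..<p} \<le> \<theta>" and \<theta>: "\<epsilon> \<le> \<theta>" "0 \<le> \<theta>" "\<theta> \<le> 1" and k: "k < n"
  shows "map_size p \<Phi> / n * (1 - \<theta>)\<^sup>2 \<le> m k" "m k \<le> map_size p \<Phi> / n * (1 + \<theta>)\<^sup>2"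
proof -
  interpret weight_expander n p "kraus_weight U V As" "map_size p \<Phi>" \<epsilon> \<mu>
    by (rule quantum_expander_imp_weight_expander[OF rep U V exp p n])
  have x: "\<bar>x l - 1\<bar> \<le> \<theta>" if "l < p" for l
    using abs_le_L2_set[of "{..<p}" l "\<lambda>l. x l - 1"] close that by simp
  have "m k = (\<Sum>l<p. kraus_weight U V As k l * x l)"
    using kraus_map_spectral_eigenvalues[OF kraus_repD(1)[OF rep] U V _ k] eq
    by (simp add: kraus_repD(2)[OF rep spectral_mat_carrier[OF U]])
  then show "map_size p \<Phi> / n * (1 - \<theta>)\<^sup>2 \<le> m k" "m k \<le> map_size p \<Phi> / n * (1 + \<theta>)\<^sup>2"
    using weighted_row_sum_bounds[OF x \<theta> k] by simp_all
qed

lemma expander_det_minimizer: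
  assumes rep: "kraus_rep p n \<Phi> As" and exp: "quantum_expander p n \<epsilon> \<mu> \<Phi>"
    and p: "0 < p" and n: "0 < n" and s: "0 < map_size p \<Phi>"
    and \<mu>: "0 \<le> \<mu>" "\<mu> < 1" and \<epsilon>: "0 \<le> \<epsilon>" "\<epsilon> \<le> (1 - \<mu>) / 2"
  obtains U x V m where "unitary_mat p U" "unitary_mat n V" "\<Phi> (spectral_mat p U x) = spectral_mat n V m"
    "(\<Prod>l<p. x l) = 1" "L2_set (\<lambda>l. x l - 1) {..<p} \<le> 24 * (\<epsilon> * sqrt p / (1 - \<mu>))"
    "\<And>Y. Y \<in> herm_det_ball p (1 / 3) \<Longrightarrow> (\<Prod>k<n. m k) \<le> Re (det (\<Phi> Y))"
proof -
  obtain U x V m where U: "unitary_mat p U" and V: "unitary_mat n V"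
    and eq: "\<Phi> (spectral_mat p U x) = spectral_mat n V m"
    and ball: "spectral_mat p U x \<in> herm_det_ball p (1 / 3)"
    and min: "\<And>Y. Y \<in> herm_det_ball p (1 / 3) \<Longrightarrow> (\<Prod>k<n. m k) \<le> Re (det (\<Phi> Y))"
    by (rule det_minimizer_spectral[OF rep, of "1 / 3"]) auto
  have prod_x: "(\<Prod>l<p. x l) = 1" using ball unfolding spectral_mat_in_herm_det_ball_iff[OF U] by blast
  have "Re (det (\<Phi> (spectral_mat p U x))) \<le> Re (det (\<Phi> (1\<^sub>m p)))"
    using min[OF one_in_herm_det_ball] by (simp add: eq det_spectral_mat[OF V] del: of_real_prod)
  then have "L2_set (\<lambda>l. x l - 1) {..<p} \<le> 24 * (\<epsilon> * sqrt p / (1 - \<mu>))"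
    by (rule det_minimizer_close_to_one[OF rep exp p n s \<mu> \<epsilon> U V eq ball])
  then show thesis by (rule that[OF U V eq prod_x]) (rule min)
qed

theorem expander_scaling_if_size_pos:
  assumes rep: "kraus_rep p n \<Phi> As" and exp: "quantum_expander p n \<epsilon> (1 - lam) \<Phi>"
    and p: "0 < p" and n: "0 < n" and s: "0 < map_size p \<Phi>" and \<epsilon>: "0 \<le> \<epsilon>" and lam: "0 < lam" "lam \<le> 1"
  defines "\<tau> \<equiv> \<epsilon> * sqrt p / lam"
  assumes small: "\<tau> \<le> 1 / 100"
  obtains L R where "L \<in> carrier_mat p p" "R \<in> carrier_mat n n" "det L = 1" "det R = 1"
    "doubly_balanced p n (scaling \<Phi> L R)"
    "frob_norm (1\<^sub>m p - mat_adjoint L * L) \<le> 24 * \<tau>" "op_norm_mat (1\<^sub>m n - mat_adjoint R * R) \<le> 192 * \<tau>"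
proof -
  define \<theta> where "\<theta> = 24 * \<tau>"
  define q where "q = map_size p \<Phi> / n"
  have \<epsilon>_small: "\<epsilon> \<le> lam / 2" "\<epsilon> \<le> \<tau>"
    using expander_parameters_small[OF p \<epsilon> lam] small unfolding \<tau>_def by auto
  then have \<theta>: "\<epsilon> \<le> \<theta>" "0 \<le> \<theta>" "\<theta> \<le> 1 / 4" unfolding \<theta>_def using \<epsilon> small by auto
  have q: "0 < q" unfolding q_def using s n by simp
  have \<mu>: "0 \<le> 1 - lam" "1 - lam < 1" "\<epsilon> \<le> (1 - (1 - lam)) / 2" using lam \<epsilon>_small(1) by auto
  obtain U x V m where U: "unitary_mat p U" and V: "unitary_mat n V"
    and eq: "\<Phi> (spectral_mat p U x) = spectral_mat n V m" and prod_x: "(\<Prod>l<p. x l) = 1"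
    and "L2_set (\<lambda>l. x l - 1) {..<p} \<le> 24 * (\<epsilon> * sqrt p / (1 - (1 - lam)))"
    and min: "\<And>Y. Y \<in> herm_det_ball p (1 / 3) \<Longrightarrow> (\<Prod>k<n. m k) \<le> Re (det (\<Phi> Y))"
    by (rule expander_det_minimizer[OF rep exp p n s \<mu>(1,2) \<epsilon> \<mu>(3)]) blast
  then have close: "L2_set (\<lambda>l. x l - 1) {..<p} \<le> \<theta>" by (simp add: \<theta>_def \<tau>_def)
  have m: "q * (1 - \<theta>)\<^sup>2 \<le> m k" "m k \<le> q * (1 + \<theta>)\<^sup>2" if "k < n" for k
    using expander_map_eigenvalue_bounds[OF rep exp p n U V eq close \<theta>(1,2) _ that] \<theta>(3)
    unfolding q_def by auto
  have lower: "0 < q * (1 - \<theta>)\<^sup>2" using q \<theta> by (intro mult_pos_pos) auto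
  have m_pos: "0 < m k" if "k < n" for k using m(1)[OF that] lower by linarith
  obtain g where g: "q * (1 - \<theta>)\<^sup>2 \<le> g" "g \<le> q * (1 + \<theta>)\<^sup>2" and g_power: "g ^ n = (\<Prod>k<n. m k)"
    using geometric_mean_bounds[of "{..<n}" "q * (1 - \<theta>)\<^sup>2" m "q * (1 + \<theta>)\<^sup>2"] m lower n
    by (auto simp: lessThan_empty_iff)
  have g_pos: "0 < g" using g(1) lower by linarith
  let ?L = "spectral_mat p U (\<lambda>l. sqrt (x l))" and ?R = "spectral_mat n V (\<lambda>k. sqrt (g / m k))"
  have "L2_set (\<lambda>l. x l - 1) {..<p} < 1 / 3" using close \<theta>(3) by simp
  note factors = scaling_factors_at_minimum[OF rep p n U V eq prod_x this _ m_pos g_pos g_power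
      min[folded g_power], simplified]
  have "frob_norm (1\<^sub>m p - mat_adjoint ?L * ?L) \<le> 24 * \<tau>"
    using close by (simp add: factors(1) frob_norm_one_minus_spectral_mat[OF U] \<theta>_def)
  moreover have "op_norm_mat (1\<^sub>m n - mat_adjoint ?R * ?R) \<le> 192 * \<tau>"
    using op_norm_one_minus_spectral_mat_le[OF V abs_ratio_minus_one_le[OF q \<theta>(2,3) g m]] \<theta>
    by (simp add: factors(2) \<theta>_def)
  ultimately show thesis
    by (intro that[of ?L ?R] factors(3-5) spectral_mat_carrier[OF U] spectral_mat_carrier[OF V])
qed

lemma map_size_nonneg:
  assumes "kraus_rep p n \<Phi> As"
  shows "0 \<le> map_size p \<Phi>"
  unfolding sum_kraus_weight[OF assms unitary_mat_one unitary_mat_one, symmetric]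
  by (intro sum_nonneg kraus_weight_nonneg)

lemma doubly_balanced_if_size_zero:
  "eps_doubly_balanced p n \<epsilon> \<Phi> \<Longrightarrow> map_size p \<Phi> = 0 \<Longrightarrow> doubly_balanced p n \<Phi>"
  by (simp add: doubly_balanced_def eps_doubly_balanced_def)

lemma doubly_balanced_scaling_one:
  assumes rep: "kraus_rep p n \<Phi> As" and bal: "doubly_balanced p n \<Phi>"
  shows "doubly_balanced p n (scaling \<Phi> (1\<^sub>m p) (1\<^sub>m n))"
proof -
  let ?\<Psi> = "scaling \<Phi> (1\<^sub>m p) (1\<^sub>m n)"
  have eq: "?\<Psi> X = \<Phi> X" if "X \<in> carrier_mat p p" for X
    using that by (simp add: scaling_def kraus_repD(2)[OF rep] left_mult_one_mat[OF kraus_map_carrier]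
        right_mult_one_mat[OF kraus_map_carrier])
  then have rep': "kraus_rep p n ?\<Psi> As" using rep unfolding kraus_rep_def by simp
  show ?thesis
    using bal unfolding doubly_balanced_def eps_doubly_balanced_def map_size_def eq[OF one_carrier_mat]
      dual_map_eq[OF rep one_carrier_mat] dual_map_eq[OF rep' one_carrier_mat] .
qed

theorem expander_scaling:
  assumes cp: "completely_positive p n \<Phi>" and exp: "quantum_expander p n \<epsilon> (1 - lam) \<Phi>"
    and p: "0 < p" and n: "0 < n" and \<epsilon>: "0 \<le> \<epsilon>" and lam: "0 < lam" "lam \<le> 1"
  defines "\<tau> \<equiv> \<epsilon> * sqrt p / lam"
  assumes small: "\<tau> \<le> 1 / 100"
  obtains L R where "L \<in> carrier_mat p p" "R \<in> carrier_mat n n" "det L = 1" "det R = 1"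
    "doubly_balanced p n (scaling \<Phi> L R)"
    "frob_norm (1\<^sub>m p - mat_adjoint L * L) \<le> 192 * \<tau>" "op_norm_mat (1\<^sub>m n - mat_adjoint R * R) \<le> 192 * \<tau>"
proof -
  obtain As where rep: "kraus_rep p n \<Phi> As" using cp unfolding completely_positive_def by blast
  have \<tau>: "0 \<le> \<tau>" unfolding \<tau>_def using \<epsilon> lam by simp
  show thesis
  proof (cases "map_size p \<Phi> = 0")
    case True
    then have "doubly_balanced p n (scaling \<Phi> (1\<^sub>m p) (1\<^sub>m n))"
      using exp unfolding quantum_expander_def
      by (intro doubly_balanced_scaling_one[OF rep] doubly_balanced_if_size_zero) auto
    moreover have "frob_norm (1\<^sub>m p - 1\<^sub>m p) \<le> 192 * \<tau>" using \<tau> by (simp add: frob_norm_def)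
    moreover have "op_norm_mat (1\<^sub>m n - 1\<^sub>m n) \<le> 192 * \<tau>" using \<tau> op_norm_minus_self_le[of "1\<^sub>m n"] by simp
    ultimately show ?thesis by (intro that[of "1\<^sub>m p" "1\<^sub>m n"]) simp_all
  next
    case False
    then have "0 < map_size p \<Phi>" using map_size_nonneg[OF rep] by simp
    then obtain L R where "L \<in> carrier_mat p p" "R \<in> carrier_mat n n" "det L = 1" "det R = 1"
        "doubly_balanced p n (scaling \<Phi> L R)" "frob_norm (1\<^sub>m p - mat_adjoint L * L) \<le> 24 * \<tau>"
        "op_norm_mat (1\<^sub>m n - mat_adjoint R * R) \<le> 192 * \<tau>"
      unfolding \<tau>_def
      by (rule expander_scaling_if_size_pos[OF rep exp p n _ \<epsilon> lam small[unfolded \<tau>_def]])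
    then show ?thesis using \<tau> by (intro that[of L R]) auto
  qed
qed

theorem theorem2p12:
  shows "\<exists>c > (0::real). \<exists>C > (0::real).
    \<forall>(p::nat) (n::nat) (\<Phi> :: complex mat \<Rightarrow> complex mat) (\<epsilon>::real) (lam::real).
      p \<ge> 1 \<and> n \<ge> 1 \<and> completely_positive p n \<Phi> \<and>
      \<epsilon> \<ge> 0 \<and> 0 < lam \<and> lam \<le> 1 \<and>
      quantum_expander p n \<epsilon> (1 - lam) \<Phi> \<and>
      \<epsilon> * sqrt (real p) / lam \<le> c
      \<longrightarrow>
      (\<exists>L R. L \<in> carrier_mat p p \<and> invertible_mat L \<and>
             R \<in> carrier_mat n n \<and> invertible_mat R \<and>
             det L = 1 \<and> det R = 1 \<and>
             doubly_balanced p n (scaling \<Phi> L R) \<and>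
             frob_norm (1\<^sub>m p - mat_adjoint L * L) \<le> C * (\<epsilon> * sqrt (real p) / lam) \<and>
             op_norm_mat (1\<^sub>m n - mat_adjoint R * R) \<le> C * (\<epsilon> * sqrt (real p) / lam))"
proof (rule exI[of _ "1 / 100"], rule conjI[rotated], rule exI[of _ 192], rule conjI[rotated],
    intro allI impI)
  fix p n :: nat and \<Phi> :: "complex mat \<Rightarrow> complex mat" and \<epsilon> lam :: real
  assume asm: "p \<ge> 1 \<and> n \<ge> 1 \<and> completely_positive p n \<Phi> \<and> \<epsilon> \<ge> 0 \<and> 0 < lam \<and> lam \<le> 1 \<and>
    quantum_expander p n \<epsilon> (1 - lam) \<Phi> \<and> \<epsilon> * sqrt (real p) / lam \<le> 1 / 100"
  obtain L R where "L \<in> carrier_mat p p" "R \<in> carrier_mat n n" "det L = 1" "det R = 1"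
      "doubly_balanced p n (scaling \<Phi> L R)"
      "frob_norm (1\<^sub>m p - mat_adjoint L * L) \<le> 192 * (\<epsilon> * sqrt (real p) / lam)"
      "op_norm_mat (1\<^sub>m n - mat_adjoint R * R) \<le> 192 * (\<epsilon> * sqrt (real p) / lam)"
    by (rule expander_scaling[of p n \<Phi> \<epsilon> lam]) (use asm in auto)
  then show "\<exists>L R. L \<in> carrier_mat p p \<and> invertible_mat L \<and> R \<in> carrier_mat n n \<and> invertible_mat R \<and>
      det L = 1 \<and> det R = 1 \<and> doubly_balanced p n (scaling \<Phi> L R) \<and>
      frob_norm (1\<^sub>m p - mat_adjoint L * L) \<le> 192 * (\<epsilon> * sqrt (real p) / lam) \<and>
      op_norm_mat (1\<^sub>m n - mat_adjoint R * R) \<le> 192 * (\<epsilon> * sqrt (real p) / lam)"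
    using invertible_mat_det_one by blast
qed simp_all

end
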